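(* Let $r\in\mathbb{N}$, $r\ge 1$. Then $$c'_r\,\gamma_r^* \;\le\; \sup_{f\in C}\frac{E_{n-1}(f)}{\omega_r\left(f,\frac{2\pi}{n}\right)}\;\le\; c_r\,\gamma_r^*,$$ where the lower bound holds for all integers $n\ge 2r$ with $$c'_r=\begin{cases}1-\frac{1}{r+1}, & r \text{ odd},\\ 1, & r\text{ even},\end{cases}$$ and the upper bound holds for all integers $n\ge 1$ with $c_r=5$.
   Context: $C$ is the space of continuous $2\pi$-periodic functions $f$ on $\mathbb{R}$ with the uniform norm $\|f\|$ (in the supremum of ratios, $f$ ranges over functions with nonzero denominator, i.e. nonconstant $f$). $T_{n-1}$ is the space of trigonometric polynomials of degree $\le n-1$, and $E_{n-1}(f)=\inf_{\tau\in T_{n-1}}\|f-\tau\|$. The $r$-th modulus of smoothness is $\omega_r(f,\delta)=\sup_{0<h\le\delta}\|\Delta_h^r(f,\cdot)\|$, where $\Delta_h^r(f,x)=\sum_{i=0}^r(-1)^i\binom{r}{i}f(x+ih)$. Also $\gamma_r^*=\binom{r}{\lfloor r/2\rfloor}^{-1}$. *)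

theory Defs
  imports "HOL-Analysis.Analysis"
begin

definition periodic_C :: "(real \<Rightarrow> real) set" where
  "periodic_C = {f. continuous_on UNIV f \<and> (\<forall>x. f (x + 2 * pi) = f x)}"

(* The real-valued suprema and infima below are only meaningful where they are taken over nonempty
   bounded sets. For f in periodic_C and \<delta> > 0 this is always the case. *)

definition unif_norm :: "(real \<Rightarrow> real) \<Rightarrow> real" where
  "unif_norm f = (SUP x. \<bar>f x\<bar>)"

definition trig_polys :: "nat \<Rightarrow> (real \<Rightarrow> real) set" where
  "trig_polys m =
     {\<tau>. \<exists>a b :: nat \<Rightarrow> real. \<tau> = (\<lambda>x. \<Sum>k\<le>m. a k * cos (real k * x) + b k * sin (real k * x))}"

definition best_approx :: "nat \<Rightarrow> (real \<Rightarrow> real) \<Rightarrow> real" where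
  "best_approx m f = (INF \<tau>\<in>trig_polys m. unif_norm (\<lambda>x. f x - \<tau> x))"

definition fin_diff :: "nat \<Rightarrow> real \<Rightarrow> (real \<Rightarrow> real) \<Rightarrow> real \<Rightarrow> real" where
  "fin_diff r h f x = (\<Sum>i\<le>r. (-1) ^ i * real (r choose i) * f (x + real i * h))"

definition modulus_smoothness :: "nat \<Rightarrow> (real \<Rightarrow> real) \<Rightarrow> real \<Rightarrow> real" where
  "modulus_smoothness r f \<delta> = (SUP h\<in>{0<..\<delta>}. unif_norm (fin_diff r h f))"

(* The supremum is taken in the extended reals, so that its finiteness is part of any upper bound.
   The degree n - 1 is a natural-number subtraction, so n \<ge> 1 is intended. *)
definition jackson_sup :: "nat \<Rightarrow> nat \<Rightarrow> ereal" where
  "jackson_sup r n =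
     (SUP f\<in>{f \<in> periodic_C. modulus_smoothness r f (2 * pi / real n) \<noteq> 0}.
        ereal (best_approx (n - 1) f / modulus_smoothness r f (2 * pi / real n)))"

definition gamma_star :: "nat \<Rightarrow> real" where
  "gamma_star r = 1 / real (r choose (r div 2))"

definition lower_const :: "nat \<Rightarrow> real" where
  "lower_const r = (if odd r then 1 - 1 / (real r + 1) else 1)"

end

theory Submission
  imports Defs
begin

text \<open>
Write \<open>\<gamma> = gamma_star r\<close> and \<open>h = 2\<pi>/n\<close>.

The upper bound. Let \<open>r = 2k\<close>. In the central difference of order \<open>2k\<close> with step \<open>s\<close> the value
\<open>f x\<close> has the coefficient \<open>2k choose k = 1/\<gamma>\<close>, the largest of all. Solving for it expresses \<open>f x\<close>
as \<open>\<gamma>\<close> times a difference plus a fixed combination of the values \<open>f (x \<plusminus> i s)\<close>, \<open>1 \<le> i \<le> k\<close>.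
Averaging over \<open>s = h t\<close> with the weight \<open>2 (1 - t)\<close> on \<open>[0, 1]\<close> gives
\<open>f = (f - U f) + U f\<close> with \<open>\<parallel>f - U f\<parallel> \<le> \<gamma> \<omega>\<close>, where \<open>\<omega>\<close> is the modulus of order \<open>2k\<close> at \<open>h\<close> and
\<open>U f\<close> is a combination of averages of \<open>f\<close> against hat functions of half-width \<open>i h\<close>. Each average is a second
difference of a second antiderivative of \<open>f\<close> (lemma \<open>has_integral_second_difference\<close>), so \<open>U f\<close>
is twice differentiable, and its second derivative is the same combination of the second differences
of \<open>f\<close> with step \<open>i h\<close>, divided by \<open>(i h)\<^sup>2\<close>. The resulting operator on \<open>f\<close> maps trigonometric polynomials to
trigonometric polynomials and has norm at most \<open>12/h\<^sup>2\<close> (lemma \<open>smoothing_weight_bound\<close>),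
a bound that does not depend on \<open>k\<close>. Two applications of the Favard inequality, of constant \<open>\<pi>/(2n)\<close>
per derivative, therefore give \<open>E(U f) \<le> (\<pi>/(2n))\<^sup>2 (12/h\<^sup>2) E(f) = (3/4) E(f)\<close>, where \<open>E\<close> is the error of best
approximation. Hence \<open>E(f) \<le> \<gamma> \<omega> + (3/4) E(f)\<close>, that is, \<open>E(f) \<le> 4 \<gamma> \<omega>\<close>.
An odd order \<open>r\<close> reduces to \<open>r + 1\<close>: the modulus at most doubles, while \<open>gamma_star (r + 1)\<close> is half
of \<open>gamma_star r\<close>.

The Favard inequality. The function \<open>g\<close> is a constant plus \<open>1/\<pi>\<close> times the convolution of \<open>g'\<close> with
the sawtooth \<open>(\<pi> - t)/2\<close> on \<open>(0, 2\<pi>)\<close>. It suffices to approximate the sawtooth in the mean by a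
trigonometric polynomial of degree \<open>n - 1\<close> with error \<open>\<pi>\<^sup>2/(2n)\<close>. The interpolant at the nodes
\<open>m\<pi>/n\<close> does this: its error has the sign of \<open>sin (n t)\<close>, because the quotient by \<open>sin (n t)\<close> is a
sum of negated second differences of \<open>x cot x\<close>, which is concave (lemmas \<open>sawtooth_error_formula\<close> and
\<open>sawtooth_error_sign\<close>). The sign pattern annihilates every trigonometric polynomial of degree below
\<open>n\<close>, so the mean error can be read off from the sawtooth alone.

The lower bound. A square wave of amplitude 1 jumps by 2 and so has distance 1 from every
trigonometric polynomial, while its variation over half a period is 2. If \<open>n \<ge> 2r\<close>, a difference of order
\<open>r\<close> with step at most \<open>h\<close> reaches over half a period at most; written as a difference of order \<open>r - 1\<close> of
first differences it is at most \<open>2 (r - 1 choose \<lfloor>(r - 1)/2\<rfloor>)\<close>. The reciprocal of this number is exactly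
\<open>lower_const r * gamma_star r\<close>. Steep continuous ramps in place of the jumps approach these values; a uniform Lipschitz
bound for bounded trigonometric polynomials (lemma \<open>trig_poly_lipschitz\<close>) controls their distance.
\<close>

section \<open>Uniform norm and trigonometric polynomials\<close>

lemma periodic_shift_int:
  fixes f :: "real \<Rightarrow> real"
  assumes "\<And>x. f (x + p) = f x"
  shows "f (x + of_int k * p) = f x"
proof -
  have nat_case: "f (y + real m * p) = f y" for y m
  proof (induction m)
    case (Suc m)
    have "f (y + real (Suc m) * p) = f ((y + real m * p) + p)"
      by (simp add: algebra_simps)
    then show ?case using assms Suc by simp
  qed simp
  show ?thesis
  proof (cases "k \<ge> 0")
    case True
    then show ?thesis using nat_case[of x "nat k"] by simp
  next
    case False
    then show ?thesis using nat_case[of "x + of_int k * p" "nat (-k)"] by simp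
  qed
qed

lemma periodic_C_bounded:
  assumes "f \<in> periodic_C"
  obtains B where "\<And>x. \<bar>f x\<bar> \<le> B"
proof -
  have cont: "continuous_on {0..2*pi} f" and per: "\<And>x. f (x + 2*pi) = f x"
    using assms by (auto simp: periodic_C_def intro: continuous_on_subset)
  have "bounded (f ` {0..2*pi})"
    by (intro compact_imp_bounded compact_continuous_image cont) auto
  then obtain B where B: "\<And>y. y \<in> {0..2*pi} \<Longrightarrow> \<bar>f y\<bar> \<le> B"
    unfolding bounded_iff by (metis image_eqI real_norm_def)
  have "\<bar>f x\<bar> \<le> B" for x
  proof -
    define k where "k = \<lfloor>x / (2*pi)\<rfloor>"
    have "of_int k \<le> x / (2*pi)" "x / (2*pi) < of_int k + 1"
      unfolding k_def by linarith+
    then have "x + of_int (-k) * (2*pi) \<in> {0..2*pi}"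
      by (auto simp: field_simps)
    with B have "\<bar>f (x + of_int (-k) * (2*pi))\<bar> \<le> B" by blast
    then show ?thesis using periodic_shift_int[of f "2*pi" x "-k"] per by metis
  qed
  then show ?thesis using that by blast
qed

lemma abs_le_unif_norm:
  assumes "f \<in> periodic_C"
  shows "\<bar>f x\<bar> \<le> unif_norm f"
proof -
  obtain B where "\<And>x. \<bar>f x\<bar> \<le> B" using periodic_C_bounded[OF assms] by blast
  then show ?thesis unfolding unif_norm_def
    by (intro cSUP_upper bdd_aboveI2) auto
qed

lemma unif_norm_le: "(\<And>x. \<bar>f x\<bar> \<le> M) \<Longrightarrow> unif_norm f \<le> M"
  unfolding unif_norm_def by (intro cSUP_least) auto

lemma unif_norm_nonneg: "f \<in> periodic_C \<Longrightarrow> 0 \<le> unif_norm f"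
  using abs_le_unif_norm[of f 0] by linarith

lemma periodic_C_shift:
  assumes "f \<in> periodic_C" shows "(\<lambda>x. f (x + a)) \<in> periodic_C"
proof -
  have "f (x + a + 2 * pi) = f (x + a)" for x using assms by (simp add: periodic_C_def)
  then have "f (x + 2 * pi + a) = f (x + a)" for x by (metis add.assoc add.commute)
  moreover have "continuous_on UNIV (\<lambda>x. f (x + a))"
    using assms by (auto simp: periodic_C_def intro!: continuous_on_compose2[of UNIV f] continuous_intros)
  ultimately show ?thesis by (simp add: periodic_C_def)
qed

lemma periodic_C_scale: "f \<in> periodic_C \<Longrightarrow> (\<lambda>x. c * f x) \<in> periodic_C"
  by (auto simp: periodic_C_def intro!: continuous_intros)

lemma periodic_C_add:
  "f \<in> periodic_C \<Longrightarrow> g \<in> periodic_C \<Longrightarrow> (\<lambda>x. f x + g x) \<in> periodic_C"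
  by (auto simp: periodic_C_def intro!: continuous_intros)

lemma periodic_C_diff:
  "f \<in> periodic_C \<Longrightarrow> g \<in> periodic_C \<Longrightarrow> (\<lambda>x. f x - g x) \<in> periodic_C"
  by (auto simp: periodic_C_def intro!: continuous_intros)

lemma periodic_C_sum:
  "(\<And>i. i \<in> I \<Longrightarrow> f i \<in> periodic_C) \<Longrightarrow> (\<lambda>x. \<Sum>i\<in>I. f i x) \<in> periodic_C"
  by (auto simp: periodic_C_def intro!: continuous_intros sum.cong)

lemma cos_shift_periodic: "cos (a + real k * (x + 2 * pi)) = cos (a + real k * x)"
  and sin_shift_periodic: "sin (a + real k * (x + 2 * pi)) = sin (a + real k * x)"
proof -
  have *: "a + real k * (x + 2 * pi) = (a + real k * x) + 2 * real k * pi"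
    by (simp add: algebra_simps)
  show "cos (a + real k * (x + 2 * pi)) = cos (a + real k * x)"
    unfolding * using cos.plus_of_nat[of "a + real k * x" k] by (simp add: mult_ac)
  show "sin (a + real k * (x + 2 * pi)) = sin (a + real k * x)"
    unfolding * using sin.plus_of_nat[of "a + real k * x" k] by (simp add: mult_ac)
qed

lemma trig_polys_periodic_C: "\<tau> \<in> trig_polys m \<Longrightarrow> \<tau> \<in> periodic_C"
  using cos_shift_periodic[of 0] sin_shift_periodic[of 0]
  by (auto simp: trig_polys_def periodic_C_def intro!: continuous_intros)

lemma trig_polys_add:
  assumes "\<sigma> \<in> trig_polys m" "\<tau> \<in> trig_polys m"
  shows "(\<lambda>x. \<sigma> x + \<tau> x) \<in> trig_polys m"
proof -
  obtain a b a' b' where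
    "\<sigma> = (\<lambda>x. \<Sum>k\<le>m. a k * cos (real k * x) + b k * sin (real k * x))"
    "\<tau> = (\<lambda>x. \<Sum>k\<le>m. a' k * cos (real k * x) + b' k * sin (real k * x))"
    using assms by (auto simp: trig_polys_def)
  then have "(\<lambda>x. \<sigma> x + \<tau> x) =
      (\<lambda>x. \<Sum>k\<le>m. (a k + a' k) * cos (real k * x) + (b k + b' k) * sin (real k * x))"
    by (simp add: sum.distrib[symmetric] algebra_simps)
  then show ?thesis unfolding trig_polys_def
    by (intro CollectI exI[of _ "\<lambda>k. a k + a' k"] exI[of _ "\<lambda>k. b k + b' k"])
qed

lemma trig_polys_scale:
  assumes "\<tau> \<in> trig_polys m"
  shows "(\<lambda>x. c * \<tau> x) \<in> trig_polys m"
proof -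
  obtain a b where
    "\<tau> = (\<lambda>x. \<Sum>k\<le>m. a k * cos (real k * x) + b k * sin (real k * x))"
    using assms by (auto simp: trig_polys_def)
  then have "(\<lambda>x. c * \<tau> x) =
      (\<lambda>x. \<Sum>k\<le>m. (c * a k) * cos (real k * x) + (c * b k) * sin (real k * x))"
    by (simp add: sum_distrib_left algebra_simps)
  then show ?thesis unfolding trig_polys_def
    by (intro CollectI exI[of _ "\<lambda>k. c * a k"] exI[of _ "\<lambda>k. c * b k"])
qed

lemma trig_polys_cos:
  assumes "k \<le> m" shows "(\<lambda>x. cos (a + real k * x)) \<in> trig_polys m"
proof -
  have "(\<lambda>x. cos (a + real k * x)) =
     (\<lambda>x. \<Sum>j\<le>m. (if j = k then cos a else 0) * cos (real j * x)
                + (if j = k then - sin a else 0) * sin (real j * x))"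
  proof
    fix x
    have "(\<Sum>j\<le>m. (if j = k then cos a else 0) * cos (real j * x)
                + (if j = k then - sin a else 0) * sin (real j * x))
        = (\<Sum>j\<le>m. if j = k then cos (a + real k * x) else 0)"
      by (intro sum.cong) (auto simp: cos_add)
    then show "cos (a + real k * x) = (\<Sum>j\<le>m. (if j = k then cos a else 0) * cos (real j * x)
                + (if j = k then - sin a else 0) * sin (real j * x))"
      using assms by simp
  qed
  then show ?thesis unfolding trig_polys_def
    by (intro CollectI exI[of _ "\<lambda>j. if j = k then cos a else 0"]
         exI[of _ "\<lambda>j. if j = k then - sin a else 0"])
qed

lemma trig_polys_const: "(\<lambda>x. c) \<in> trig_polys m"
  using trig_polys_scale[OF trig_polys_cos[of 0 m 0], of c] by simp

lemma trig_polys_sum: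
  assumes "\<And>i. i \<in> I \<Longrightarrow> f i \<in> trig_polys m"
  shows "(\<lambda>x. \<Sum>i\<in>I. f i x) \<in> trig_polys m"
  using assms
proof (induction I rule: infinite_finite_induct)
  case (insert i I)
  then show ?case using trig_polys_add[of "f i" m "\<lambda>x. \<Sum>i\<in>I. f i x"] by simp
qed (use trig_polys_const[of 0] in auto)

lemma trig_polys_cases:
  assumes "\<tau> \<in> trig_polys m"
  obtains a b :: "nat \<Rightarrow> real" where
    "\<And>x. \<tau> x = (\<Sum>k\<le>m. a k * cos (0 + real k * x) + b k * cos (- (pi/2) + real k * x))"
proof -
  obtain a b where
    "\<tau> = (\<lambda>x. \<Sum>k\<le>m. a k * cos (real k * x) + b k * sin (real k * x))"
    using assms by (auto simp: trig_polys_def)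
  moreover have "cos (- (pi/2) + y) = sin y" for y :: real
    by (simp add: cos_diff)
  ultimately show ?thesis using that[of a b] by simp
qed

lemma trig_polys_shift:
  assumes "\<tau> \<in> trig_polys m" shows "(\<lambda>x. \<tau> (x + s)) \<in> trig_polys m"
proof -
  obtain a b where ab:
    "\<And>x. \<tau> x = (\<Sum>k\<le>m. a k * cos (0 + real k * x) + b k * cos (- (pi/2) + real k * x))"
    using trig_polys_cases[OF assms] by blast
  have "(\<lambda>x. \<Sum>k\<le>m. a k * cos (real k * s + real k * x)
      + b k * cos ((- (pi/2) + real k * s) + real k * x)) \<in> trig_polys m"
    by (intro trig_polys_sum trig_polys_add trig_polys_scale trig_polys_cos) auto
  moreover have "(\<lambda>x. \<tau> (x + s)) = (\<lambda>x. \<Sum>k\<le>m. a k * cos (real k * s + real k * x)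
      + b k * cos ((- (pi/2) + real k * s) + real k * x))"
    by (simp add: ab algebra_simps)
  ultimately show ?thesis by simp
qed

lemma best_approx_le:
  assumes "f \<in> periodic_C" "\<tau> \<in> trig_polys m" "\<And>x. \<bar>f x - \<tau> x\<bar> \<le> M"
  shows "best_approx m f \<le> M"
proof -
  have "best_approx m f \<le> unif_norm (\<lambda>x. f x - \<tau> x)"
    unfolding best_approx_def using assms
    by (intro cINF_lower bdd_belowI2[of _ 0] unif_norm_nonneg periodic_C_diff)
      (auto intro: trig_polys_periodic_C)
  also have "\<dots> \<le> M" by (intro unif_norm_le assms)
  finally show ?thesis .
qed

lemma best_approx_ge:
  assumes "f \<in> periodic_C" "\<And>\<tau> M. \<tau> \<in> trig_polys m \<Longrightarrow> (\<And>x. \<bar>f x - \<tau> x\<bar> \<le> M) \<Longrightarrow> c \<le> M"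
  shows "c \<le> best_approx m f"
  unfolding best_approx_def
proof (rule cINF_greatest)
  show "trig_polys m \<noteq> {}" using trig_polys_const[of 0] by auto
  fix \<tau> assume \<tau>: "\<tau> \<in> trig_polys m"
  show "c \<le> unif_norm (\<lambda>x. f x - \<tau> x)"
    using assms \<tau> abs_le_unif_norm[of "\<lambda>x. f x - \<tau> x"] periodic_C_diff trig_polys_periodic_C
    by blast
qed

section \<open>Differences and the modulus of smoothness\<close>

lemma fin_diff_periodic_C: "f \<in> periodic_C \<Longrightarrow> fin_diff r h f \<in> periodic_C"
  unfolding fin_diff_def[abs_def] by (intro periodic_C_sum periodic_C_scale periodic_C_shift)

lemma fin_diff_le_modulus:
  assumes f: "f \<in> periodic_C" and h: "0 < h" "h \<le> \<delta>"
  shows "\<bar>fin_diff r h f x\<bar> \<le> modulus_smoothness r f \<delta>"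
proof -
  obtain B where B: "\<And>x. \<bar>f x\<bar> \<le> B" using periodic_C_bounded[OF f] by blast
  have "\<bar>fin_diff r s f y\<bar> \<le> (\<Sum>i\<le>r. real (r choose i) * B)" for s y
    unfolding fin_diff_def
    by (rule order_trans[OF sum_abs]) (auto simp: abs_mult intro!: sum_mono mult_left_mono B)
  then have "unif_norm (fin_diff r s f) \<le> (\<Sum>i\<le>r. real (r choose i) * B)" for s
    by (intro unif_norm_le)
  then have "unif_norm (fin_diff r h f) \<le> modulus_smoothness r f \<delta>"
    unfolding modulus_smoothness_def using h by (intro cSUP_upper bdd_aboveI2) auto
  then show ?thesis
    using abs_le_unif_norm[OF fin_diff_periodic_C[OF f], of r h x] by linarith
qed

lemma modulus_le:
  assumes "0 < \<delta>" "\<And>h x. 0 < h \<Longrightarrow> h \<le> \<delta> \<Longrightarrow> \<bar>fin_diff r h f x\<bar> \<le> M"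
  shows "modulus_smoothness r f \<delta> \<le> M"
  unfolding modulus_smoothness_def using assms by (intro cSUP_least unif_norm_le) auto

lemma fin_diff_Suc: "fin_diff (Suc r) h f x = fin_diff r h f x - fin_diff r h f (x + h)"
proof -
  have "fin_diff (Suc r) h f x =
    f x + (\<Sum>i\<le>r. (-1) ^ Suc i * real (Suc r choose Suc i) * f (x + real (Suc i) * h))"
    unfolding fin_diff_def by (subst sum.atMost_Suc_shift) simp
  also have "\<dots> = f x + (\<Sum>i\<le>r. (-1) ^ Suc i * real (r choose Suc i) * f (x + real (Suc i) * h))
      + (\<Sum>i\<le>r. (-1) ^ Suc i * real (r choose i) * f (x + real (Suc i) * h))"
    by (simp add: sum.distrib[symmetric] algebra_simps)
  also have "f x + (\<Sum>i\<le>r. (-1) ^ Suc i * real (r choose Suc i) * f (x + real (Suc i) * h))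
      = (\<Sum>i\<le>Suc r. (-1) ^ i * real (r choose i) * f (x + real i * h))"
    by (subst sum.atMost_Suc_shift) simp
  also have "\<dots> = fin_diff r h f x" unfolding fin_diff_def by (simp add: binomial_eq_0)
  also have "(\<Sum>i\<le>r. (-1) ^ Suc i * real (r choose i) * f (x + real (Suc i) * h))
      = - fin_diff r h f (x + h)"
    unfolding fin_diff_def by (simp add: sum_negf[symmetric] algebra_simps)
  finally show ?thesis by simp
qed

lemma fin_diff_Suc_diff: "fin_diff (Suc r) h f x = fin_diff r h (\<lambda>x. f x - f (x + h)) x"
proof -
  have "fin_diff r h (\<lambda>x. f x - f (x + h)) x = fin_diff r h f x - fin_diff r h f (x + h)"
    unfolding fin_diff_def sum_subtractf[symmetric]
    by (intro sum.cong) (auto simp: algebra_simps)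
  then show ?thesis by (simp add: fin_diff_Suc)
qed

lemma modulus_Suc_le:
  assumes "f \<in> periodic_C" "0 < \<delta>"
  shows "modulus_smoothness (Suc r) f \<delta> \<le> 2 * modulus_smoothness r f \<delta>"
proof (rule modulus_le[OF assms(2)])
  fix h x :: real assume h: "0 < h" "h \<le> \<delta>"
  show "\<bar>fin_diff (Suc r) h f x\<bar> \<le> 2 * modulus_smoothness r f \<delta>"
    using fin_diff_le_modulus[OF assms(1) h, of r x]
      fin_diff_le_modulus[OF assms(1) h, of r "x + h"] unfolding fin_diff_Suc by linarith
qed

lemma modulus_nonneg: "f \<in> periodic_C \<Longrightarrow> 0 < \<delta> \<Longrightarrow> 0 \<le> modulus_smoothness r f \<delta>"
  using fin_diff_le_modulus[of f \<delta> \<delta> r 0] by linarith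

section \<open>Equally spaced nodes\<close>

text \<open>
Multiplication by \<open>2 sin (m\<pi>/(2n))\<close> makes the sum telescope over a whole number of periods, and this factor
does not vanish for \<open>0 < m < 2n\<close>. All orthogonality relations used below come from this one.
\<close>

lemma sum_cos_nodes:
  fixes n m :: nat and a :: real
  assumes "0 < m" "m < 2 * n"
  shows "(\<Sum>j<2*n. cos (a + real m * (real j * (pi / real n)))) = 0"
proof -
  define \<theta> where "\<theta> = pi / real n"
  have n: "0 < n" and nth: "real n * \<theta> = pi" using assms by (auto simp: \<theta>_def)
  have "real m * \<theta> / 2 < pi"
    using assms n by (simp add: \<theta>_def field_simps)
  moreover have "0 < real m * \<theta> / 2" using assms n by (simp add: \<theta>_def)
  ultimately have s: "sin (real m * \<theta> / 2) > 0" by (rule sin_gt_zero[rotated])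
  define A where "A j = sin (a + real m * (real j * \<theta>) - real m * \<theta> / 2)" for j
  have step: "2 * sin (real m * \<theta> / 2) * cos (a + real m * (real j * \<theta>)) = A (Suc j) - A j" for j
  proof -
    have "A (Suc j) = sin ((a + real m * (real j * \<theta>)) + real m * \<theta> / 2)"
      by (simp add: A_def algebra_simps)
    then show ?thesis unfolding A_def
      by (simp only: sin_add sin_diff) (simp add: algebra_simps)
  qed
  have "A (2*n) = sin ((a - real m * \<theta> / 2) + real m * (0 + 2 * pi))"
    unfolding A_def using nth by (simp add: algebra_simps flip: nth)
  also have "\<dots> = A 0" by (subst sin_shift_periodic) (simp add: A_def)
  finally have "2 * sin (real m * \<theta> / 2) * (\<Sum>j<2*n. cos (a + real m * (real j * \<theta>))) = 0"
    unfolding sum_distrib_left step sum_lessThan_telescope by simp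
  with s show ?thesis by (simp add: \<theta>_def)
qed

lemma cos_alternating_node:
  assumes "0 < n"
  shows "(-1) ^ j * cos (a + real k * (real j * (pi / real n)))
       = cos (a + real (k + n) * (real j * (pi / real n)))"
proof -
  have "cos (a + real (k + n) * (real j * (pi / real n)))
      = cos ((a + real k * (real j * (pi / real n))) + real j * pi)"
    using assms by (simp add: field_simps)
  then show ?thesis by (simp add: cos_add)
qed

text \<open>
The sign pattern of \<open>sin (n t)\<close> is orthogonal to the polynomials of degree below \<open>n\<close>, and this already holds
pointwise for the samples at shifted nodes: the alternating sign raises each frequency \<open>k < n\<close> to
\<open>k + n\<close>, which is still below \<open>2n\<close>.
\<close>

lemma trig_poly_alternating_sum:
  assumes "\<tau> \<in> trig_polys (n - 1)" "0 < n"
  shows "(\<Sum>j<2*n. (-1) ^ j * \<tau> (real j * (pi / real n) + v)) = 0"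
proof -
  obtain a b where ab:
    "\<And>x. \<tau> x = (\<Sum>k\<le>n-1. a k * cos (0 + real k * x) + b k * cos (- (pi/2) + real k * x))"
    using trig_polys_cases[OF assms(1)] by blast
  have *: "(\<Sum>j<2*n. (-1) ^ j * cos (c + real k * (real j * (pi / real n) + v))) = 0"
    if "k \<le> n - 1" for k c
  proof -
    have "(\<Sum>j<2*n. (-1) ^ j * cos (c + real k * (real j * (pi / real n) + v)))
        = (\<Sum>j<2*n. (-1) ^ j * cos ((c + real k * v) + real k * (real j * (pi / real n))))"
      by (simp add: algebra_simps)
    also have "\<dots> = 0"
      unfolding cos_alternating_node[OF assms(2)] using assms(2) that by (intro sum_cos_nodes) auto
    finally show ?thesis .
  qed
  have "(\<Sum>j<2*n. (-1) ^ j * \<tau> (real j * (pi / real n) + v)) =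
     (\<Sum>k\<le>n-1. a k * (\<Sum>j<2*n. (-1) ^ j * cos (0 + real k * (real j * (pi / real n) + v)))
       + b k * (\<Sum>j<2*n. (-1) ^ j * cos (- (pi/2) + real k * (real j * (pi / real n) + v))))"
    unfolding ab sum_distrib_left sum.distrib[symmetric]
    by (subst sum.swap) (auto intro!: sum.cong simp: algebra_simps)
  also have "\<dots> = 0"
  proof (intro sum.neutral ballI)
    fix k assume "k \<in> {..n-1}"
    then have k: "k \<le> n - 1" by simp
    show "a k * (\<Sum>j<2*n. (-1) ^ j * cos (0 + real k * (real j * (pi / real n) + v)))
       + b k * (\<Sum>j<2*n. (-1) ^ j * cos (- (pi/2) + real k * (real j * (pi / real n) + v))) = 0"
      by (simp only: *[OF k, of 0] *[OF k, of "- (pi/2)"] mult_zero_right add_0_right)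
  qed
  finally show ?thesis .
qed

text \<open>
For \<open>n \<ge> 1\<close> this is \<open>1 + 2 (cos u + \<dots> + cos ((n - 1) u))\<close>; the term of index 0 is counted twice and corrected.
\<close>

definition dirichlet_kernel :: "nat \<Rightarrow> real \<Rightarrow> real" where
  "dirichlet_kernel n u = 2 * (\<Sum>k<n. cos (real k * u)) - 1"

lemma dirichlet_kernel_shift_trig_poly:
  assumes "0 < n"
  shows "(\<lambda>x. dirichlet_kernel n (x - s)) \<in> trig_polys (n - 1)"
proof -
  have "(\<lambda>x. (\<Sum>k<n. 2 * cos (- (real k * s) + real k * x)) + (-1)) \<in> trig_polys (n - 1)"
    using assms
    by (intro trig_polys_add[OF trig_polys_sum] trig_polys_const trig_polys_scale trig_polys_cos) auto
  then show ?thesis by (simp add: dirichlet_kernel_def algebra_simps sum_distrib_left)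
qed

text \<open>
Adding the single frequency \<open>n\<close> gives the Lagrange kernel of the \<open>2n\<close> equally spaced nodes. It has
degree \<open>n\<close>, but it vanishes at all nodes except 0 and has a closed form.
\<close>

lemma dirichlet_kernel_plus_cos:
  assumes "sin (u/2) \<noteq> 0"
  shows "dirichlet_kernel n u + cos (real n * u) = sin (real n * u) * cot (u/2)"
proof -
  have sum_to_prod: "cos (y - z) + cos (y + z) = 2 * cos y * cos z"
    "sin (y + z) - sin (y - z) = 2 * cos y * sin z" for y z :: real
    by (simp_all add: cos_add cos_diff sin_add sin_diff)
  define D where "D n = dirichlet_kernel n u + cos (real n * u)" for n
  have "D n * sin (u/2) = sin (real n * u) * cos (u/2)"
  proof (induction n)
    case (Suc n)
    have "D (Suc n) = D n + (cos (real n * u) + cos (real (Suc n) * u))"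
      by (simp add: D_def dirichlet_kernel_def)
    moreover have e: "real n * u = (real n * u + u/2) - u/2"
      "real (Suc n) * u = (real n * u + u/2) + u/2" by (simp_all add: algebra_simps)
    have "cos (real n * u) + cos (real (Suc n) * u) = 2 * cos (real n * u + u/2) * cos (u/2)"
      by (subst e(1), subst e(2)) (rule sum_to_prod(1))
    moreover have "sin (real (Suc n) * u) - sin (real n * u) = 2 * cos (real n * u + u/2) * sin (u/2)"
      by (subst e(1), subst e(2)) (rule sum_to_prod(2))
    ultimately have "D (Suc n) * sin (u/2) = D n * sin (u/2)
        + cos (u/2) * (sin (real (Suc n) * u) - sin (real n * u))"
      by (simp add: algebra_simps)
    then show ?case using Suc.IH by (simp add: algebra_simps)
  qed (simp add: D_def dirichlet_kernel_def)
  then show ?thesis using assms by (simp add: D_def cot_def field_simps)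
qed

lemma sum_dirichlet_nodes:
  assumes "0 < n"
  shows "(\<Sum>m<2*n. dirichlet_kernel n (x - real m * (pi / real n))
            + cos (real n * (x - real m * (pi / real n)))) = 2 * real n"
proof -
  have *: "(\<Sum>m<2*n. cos (real k * (x - real m * (pi / real n)))) = 0" if "0 < k" "k \<le> n" for k
  proof -
    have "(\<Sum>m<2*n. cos (real k * (x - real m * (pi / real n))))
        = (\<Sum>m<2*n. cos (- (real k * x) + real k * (real m * (pi / real n))))"
      by (intro sum.cong refl) (subst cos_minus[symmetric], simp add: right_diff_distrib)
    also have "\<dots> = 0" using assms that by (intro sum_cos_nodes) auto
    finally show ?thesis .
  qed
  have "(\<Sum>m<2*n. \<Sum>k<n. cos (real k * (x - real m * (pi / real n))))
      = (\<Sum>k<n. \<Sum>m<2*n. cos (real k * (x - real m * (pi / real n))))"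
    by (rule sum.swap)
  also have "\<dots> = (\<Sum>k<n. if k = 0 then 2 * real n else 0)"
  proof (intro sum.cong refl)
    fix k assume "k \<in> {..<n}"
    with *[of k] show "(\<Sum>m<2*n. cos (real k * (x - real m * (pi / real n))))
        = (if k = 0 then 2 * real n else 0)" by (cases "k = 0") simp_all
  qed
  also have "\<dots> = 2 * real n" using assms by simp
  finally show ?thesis
    unfolding dirichlet_kernel_def using *[of n] assms
    by (simp add: sum.distrib sum_subtractf sum_distrib_left[symmetric])
qed

lemma trig_poly_reproduction:
  assumes "\<tau> \<in> trig_polys (n - 1)" "0 < n"
  shows "(\<Sum>j<2*n. \<tau> (real j * (pi / real n)) * dirichlet_kernel n (x - real j * (pi / real n)))
       = 2 * real n * \<tau> x"
proof -
  define t where "t j = real j * (pi / real n)" for j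
  obtain a b where ab:
    "\<And>x. \<tau> x = (\<Sum>k\<le>n-1. a k * cos (0 + real k * x) + b k * cos (- (pi/2) + real k * x))"
    using trig_polys_cases[OF assms(1)] by blast
  have z: "(\<Sum>j<2*n. cos (c + real m * t j)) = 0" if "0 < m" "m < 2 * n" for c m
    unfolding t_def by (rule sum_cos_nodes[OF that])
  have *: "(\<Sum>j<2*n. cos (c + real k * t j) * dirichlet_kernel n (x - t j))
         = 2 * real n * cos (c + real k * x)" if k: "k \<le> n - 1" for k c
  proof -
    have p: "2 * (cos (c + real k * t j) * cos (real l * (x - t j)))
        = cos ((c + real l * x) + (real k - real l) * t j)
        + cos ((c - real l * x) + real (k + l) * t j)" for j l
    proof -
      have "(c + real l * x) + (real k - real l) * t j = (c + real k * t j) + real l * (x - t j)"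
        "(c - real l * x) + real (k + l) * t j = (c + real k * t j) - real l * (x - t j)"
        by (simp_all add: algebra_simps)
      then show ?thesis by (simp only: cos_add cos_diff)
    qed
    have s1: "(\<Sum>j<2*n. cos ((c + real l * x) + (real k - real l) * t j))
       = (if l = k then 2 * real n * cos (c + real k * x) else 0)" if "l < n" for l
    proof -
      consider "l = k" | "l < k" | "k < l" by linarith
      then show ?thesis
      proof cases
        case 2
        then have e: "real k - real l = real (k - l)" by simp
        have "(\<Sum>j<2*n. cos ((c + real l * x) + (real k - real l) * t j)) = 0"
          unfolding e using 2 k assms(2) by (intro z) auto
        then show ?thesis using 2 by simp
      next
        case 3
        have "cos ((c + real l * x) + (real k - real l) * t j)
            = cos (- (c + real l * x) + real (l - k) * t j)" for j
          by (subst cos_minus[symmetric], rule arg_cong[where f = cos])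
            (use 3 in \<open>simp add: of_nat_diff left_diff_distrib\<close>)
        then have "(\<Sum>j<2*n. cos ((c + real l * x) + (real k - real l) * t j))
            = (\<Sum>j<2*n. cos (- (c + real l * x) + real (l - k) * t j))"
          by (intro sum.cong refl)
        also have "\<dots> = 0" using 3 that by (intro z) auto
        finally show ?thesis using 3 by simp
      qed auto
    qed
    have s2: "(\<Sum>j<2*n. cos ((c - real l * x) + real (k + l) * t j))
       = (if k + l = 0 then 2 * real n * cos c else 0)" if "l < n" for l
    proof (cases "k + l = 0")
      case False
      have "(\<Sum>j<2*n. cos ((c - real l * x) + real (k + l) * t j)) = 0"
        using False that k assms(2) by (intro z) auto
      then show ?thesis unfolding if_not_P[OF False] .
    qed simp
    have s3: "(\<Sum>j<2*n. cos (c + real k * t j)) = (if k = 0 then 2 * real n * cos c else 0)"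
      using z[of k c] k assms(2) by auto
    have "(\<Sum>j<2*n. cos (c + real k * t j) * dirichlet_kernel n (x - t j))
      = (\<Sum>j<2*n. (\<Sum>l<n. 2 * (cos (c + real k * t j) * cos (real l * (x - t j))))
           - cos (c + real k * t j))"
      by (simp add: dirichlet_kernel_def algebra_simps sum_distrib_left)
    also have "\<dots> = (\<Sum>l<n. (\<Sum>j<2*n. cos ((c + real l * x) + (real k - real l) * t j))
         + (\<Sum>j<2*n. cos ((c - real l * x) + real (k + l) * t j)))
         - (\<Sum>j<2*n. cos (c + real k * t j))"
      unfolding p sum_subtractf by (subst sum.swap) (simp add: sum.distrib)
    also have "\<dots> = (\<Sum>l<n. (if l = k then 2 * real n * cos (c + real k * x) else 0)
         + (if l = 0 then (if k = 0 then 2 * real n * cos c else 0) else 0))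
         - (if k = 0 then 2 * real n * cos c else 0)"
      unfolding s3
    proof (intro arg_cong2[where f = "(-)"] sum.cong refl)
      fix l assume "l \<in> {..<n}"
      then have l: "l < n" by simp
      show "(\<Sum>j<2*n. cos ((c + real l * x) + (real k - real l) * t j))
         + (\<Sum>j<2*n. cos ((c - real l * x) + real (k + l) * t j))
         = (if l = k then 2 * real n * cos (c + real k * x) else 0)
         + (if l = 0 then (if k = 0 then 2 * real n * cos c else 0) else 0)"
        unfolding s1[OF l] s2[OF l] by simp
    qed
    also have "\<dots> = 2 * real n * cos (c + real k * x)"
      using k assms(2) by (simp add: sum.distrib)
    finally show ?thesis .
  qed
  have "(\<Sum>j<2*n. \<tau> (t j) * dirichlet_kernel n (x - t j)) =
     (\<Sum>k\<le>n-1. a k * (\<Sum>j<2*n. cos (0 + real k * t j) * dirichlet_kernel n (x - t j))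
       + b k * (\<Sum>j<2*n. cos (- (pi/2) + real k * t j) * dirichlet_kernel n (x - t j)))"
    unfolding ab sum_distrib_left sum_distrib_right sum.distrib[symmetric]
    by (subst sum.swap) (auto intro!: sum.cong simp: algebra_simps)
  also have "\<dots> = (\<Sum>k\<le>n-1. a k * (2 * real n * cos (0 + real k * x))
       + b k * (2 * real n * cos (- (pi/2) + real k * x)))"
    by (intro sum.cong refl arg_cong2[where f = "(+)"] arg_cong2[where f = "(*)"] *) auto
  also have "\<dots> = 2 * real n * \<tau> x"
    unfolding ab sum_distrib_left by (intro sum.cong) (auto simp: algebra_simps)
  finally show ?thesis unfolding t_def .
qed

text \<open>
A crude form of Bernstein's inequality. Through the reproducing formula the kernel, which depends on \<open>n\<close> alone,
passes its Lipschitz constant on to every bounded polynomial of degree below \<open>n\<close>.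
\<close>

lemma trig_poly_lipschitz:
  assumes "\<tau> \<in> trig_polys (n - 1)" "0 < n" "\<And>x. \<bar>\<tau> x\<bar> \<le> M"
  shows "\<bar>\<tau> x - \<tau> y\<bar> \<le> 2 * (real n)\<^sup>2 * M * \<bar>x - y\<bar>"
proof -
  have M: "0 \<le> M" using assms(3)[of 0] by linarith
  have cos_lip: "\<bar>cos a - cos b\<bar> \<le> \<bar>a - b\<bar>" for a b :: real
  proof -
    have "\<bar>cos a - cos b\<bar> = 2 * \<bar>sin ((a + b)/2)\<bar> * \<bar>sin ((b - a)/2)\<bar>"
      by (simp add: cos_diff_cos abs_mult)
    also have "\<dots> \<le> 2 * 1 * \<bar>(b - a)/2\<bar>"
      by (intro mult_mono abs_sin_x_le_abs_x) auto
    finally show ?thesis by simp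
  qed
  have D: "\<bar>dirichlet_kernel n u - dirichlet_kernel n v\<bar> \<le> 2 * (real n)\<^sup>2 * \<bar>u - v\<bar>" for u v
  proof -
    have "dirichlet_kernel n u - dirichlet_kernel n v
        = 2 * (\<Sum>k<n. cos (real k * u) - cos (real k * v))"
      by (simp add: dirichlet_kernel_def sum_subtractf right_diff_distrib)
    then have "\<bar>dirichlet_kernel n u - dirichlet_kernel n v\<bar>
        = 2 * \<bar>\<Sum>k<n. cos (real k * u) - cos (real k * v)\<bar>"
      by (simp add: abs_mult)
    also have "\<dots> \<le> 2 * (\<Sum>k<n. real n * \<bar>u - v\<bar>)"
    proof (intro mult_left_mono order_trans[OF sum_abs] sum_mono)
      fix k assume "k \<in> {..<n}"
      have "\<bar>cos (real k * u) - cos (real k * v)\<bar> \<le> \<bar>real k * u - real k * v\<bar>" by (rule cos_lip)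
      also have "\<dots> = real k * \<bar>u - v\<bar>"
        by (simp add: abs_mult flip: right_diff_distrib)
      also have "\<dots> \<le> real n * \<bar>u - v\<bar>" using \<open>k \<in> {..<n}\<close> by (intro mult_right_mono) auto
      finally show "\<bar>cos (real k * u) - cos (real k * v)\<bar> \<le> real n * \<bar>u - v\<bar>" .
    qed auto
    finally show ?thesis by (simp add: power2_eq_square)
  qed
  have "2 * real n * \<bar>\<tau> x - \<tau> y\<bar> = \<bar>2 * real n * \<tau> x - 2 * real n * \<tau> y\<bar>"
    by (simp add: abs_mult flip: right_diff_distrib)
  also have "\<dots> = \<bar>\<Sum>j<2*n. \<tau> (real j * (pi / real n)) *
       (dirichlet_kernel n (x - real j * (pi / real n)) - dirichlet_kernel n (y - real j * (pi / real n)))\<bar>"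
    unfolding trig_poly_reproduction[OF assms(1,2), symmetric] sum_subtractf[symmetric]
    by (simp add: right_diff_distrib)
  also have "\<dots> \<le> (\<Sum>j<2*n. M * (2 * (real n)\<^sup>2 * \<bar>x - y\<bar>))"
  proof (intro order_trans[OF sum_abs] sum_mono)
    fix j
    show "\<bar>\<tau> (real j * (pi / real n)) * (dirichlet_kernel n (x - real j * (pi / real n))
       - dirichlet_kernel n (y - real j * (pi / real n)))\<bar> \<le> M * (2 * (real n)\<^sup>2 * \<bar>x - y\<bar>)"
      unfolding abs_mult
      using D[of "x - real j * (pi / real n)" "y - real j * (pi / real n)"]
      by (intro mult_mono assms(3) M) auto
  qed
  also have "\<dots> = 2 * real n * (2 * (real n)\<^sup>2 * M * \<bar>x - y\<bar>)" by simp
  finally have "2 * real n * \<bar>\<tau> x - \<tau> y\<bar> \<le> 2 * real n * (2 * (real n)\<^sup>2 * M * \<bar>x - y\<bar>)" .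
  moreover have "0 < 2 * real n" using assms(2) by simp
  ultimately show ?thesis by (rule mult_left_le_imp_le)
qed

section \<open>Best mean approximation of the sawtooth\<close>

lemma x_cot_x_decreasing:
  fixes x y :: real
  assumes "0 < x" "x \<le> y" "y < pi"
  shows "y * cot y \<le> x * cot x"
proof (rule DERIV_nonpos_imp_nonincreasing[OF assms(2)])
  fix z assume z: "x \<le> z" "z \<le> y"
  with assms have s: "sin z > 0" by (intro sin_gt_zero) auto
  have "((\<lambda>z. z * cot z) has_real_derivative cot z + z * (- inverse ((sin z)\<^sup>2))) (at z)"
    using s by (auto intro!: derivative_eq_intros DERIV_cot)
  moreover have "cot z + z * (- inverse ((sin z)\<^sup>2)) \<le> 0"
  proof -
    have "sin z * cos z \<le> z"
    proof -
      have "2 * (sin z * cos z) = sin (2 * z)" by (simp add: sin_double)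
      also have "\<dots> \<le> 2 * z" using z assms by (intro sin_x_le_x) auto
      finally show ?thesis by simp
    qed
    moreover have "cot z = (sin z * cos z) / (sin z)\<^sup>2"
      using s by (simp add: cot_def power2_eq_square)
    ultimately show ?thesis using s by (simp add: field_simps)
  qed
  ultimately show "\<exists>D. ((\<lambda>z. z * cot z) has_real_derivative D) (at z) \<and> D \<le> 0" by blast
qed

text \<open>
With \<open>g x = x cot x\<close>, addition formulas give
\<open>g (m + d) + g (m - d) - 2 g m = 2 sin\<^sup>2 d (g m - g d) / (sin (m + d) sin (m - d))\<close>.
Both the numerator and the denominator change sign at \<open>\<bar>m\<bar> = d\<close>, the numerator because \<open>g\<close> is even and decreasing on \<open>(0, \<pi>)\<close>.
In this way concavity across the removable singularity at 0 needs no separate treatment.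
\<close>

lemma x_cot_x_midpoint_concave:
  fixes m d :: real
  assumes d: "0 < d" and m: "m \<noteq> 0" and a: "\<bar>m + d\<bar> < pi" "m + d \<noteq> 0"
    and b: "\<bar>m - d\<bar> < pi" "m - d \<noteq> 0"
  shows "(m + d) * cot (m + d) + (m - d) * cot (m - d) \<le> 2 * (m * cot m)"
proof -
  have sne: "sin z \<noteq> 0" if "\<bar>z\<bar> < pi" "z \<noteq> 0" for z
    using that sin_gt_zero[of z] sin_gt_zero[of "-z"] by (cases "z > 0") auto
  have mpi: "\<bar>m\<bar> < pi" and dpi: "d < pi" using a b d by linarith+
  define p where "p = sin (m + d) * sin (m - d)"
  have sm: "sin m \<noteq> 0" using sne mpi m by blast
  have sd: "sin d > 0" using d dpi by (intro sin_gt_zero)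
  have sa: "sin (m + d) \<noteq> 0" and sb: "sin (m - d) \<noteq> 0" using sne a b by blast+
  have pe: "p = (sin m)\<^sup>2 - (sin d)\<^sup>2"
  proof -
    have "p = (sin m)\<^sup>2 * (cos d)\<^sup>2 - (cos m)\<^sup>2 * (sin d)\<^sup>2"
      unfolding p_def sin_add sin_diff by (simp add: algebra_simps power2_eq_square)
    then show ?thesis by (simp add: cos_squared_eq algebra_simps)
  qed
  have "(m + d) * cot (m + d) + (m - d) * cot (m - d)
      = (m * (cos (m + d) * sin (m - d) + cos (m - d) * sin (m + d))
        + d * (cos (m + d) * sin (m - d) - cos (m - d) * sin (m + d))) / p"
    using sa sb unfolding p_def cot_def by (simp add: field_simps)
  also have "cos (m + d) * sin (m - d) + cos (m - d) * sin (m + d) = sin ((m + d) + (m - d))"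
    by (subst sin_add) simp
  also have "cos (m + d) * sin (m - d) - cos (m - d) * sin (m + d) = - sin ((m + d) - (m - d))"
    by (subst sin_diff) simp
  also have "(m + d) + (m - d) = 2 * m" by simp
  also have "(m + d) - (m - d) = 2 * d" by simp
  also have "m * sin (2 * m) = 2 * (m * cot m) * (sin m)\<^sup>2"
    using sm by (simp add: cot_def sin_double power2_eq_square)
  also have "d * - sin (2 * d) = - 2 * (d * cot d) * (sin d)\<^sup>2"
    using sd by (simp add: cot_def sin_double power2_eq_square)
  finally have "(m + d) * cot (m + d) + (m - d) * cot (m - d) - 2 * (m * cot m)
     = (2 * (m * cot m) * (sin m)\<^sup>2 - 2 * (d * cot d) * (sin d)\<^sup>2) / p - 2 * (m * cot m)"
    by simp
  also have "\<dots> = (2 * (m * cot m) * (sin m)\<^sup>2 - 2 * (d * cot d) * (sin d)\<^sup>2 - 2 * (m * cot m) * p) / p"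
    using sa sb by (simp add: p_def diff_divide_distrib)
  also have "\<dots> = 2 * (sin d)\<^sup>2 * (m * cot m - d * cot d) / p"
    by (simp add: pe algebra_simps)
  finally have key: "(m + d) * cot (m + d) + (m - d) * cot (m - d) - 2 * (m * cot m)
     = 2 * (sin d)\<^sup>2 * ((m * cot m - d * cot d) / p)" by simp
  have even: "m * cot m = \<bar>m\<bar> * cot \<bar>m\<bar>" by (simp add: abs_if cot_def)
  have "(m * cot m - d * cot d) / p \<le> 0"
  proof (cases "d < \<bar>m\<bar>")
    case True
    then have "m * cot m \<le> d * cot d"
      unfolding even using d mpi by (intro x_cot_x_decreasing) auto
    moreover have "p > 0"
    proof (cases "m > 0")
      case True
      then show ?thesis unfolding p_def using \<open>d < \<bar>m\<bar>\<close> a b d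
        by (intro mult_pos_pos sin_gt_zero) auto
    next
      case False
      have "0 < sin (- (m + d)) * sin (- (m - d))" using False \<open>d < \<bar>m\<bar>\<close> a b d
        by (intro mult_pos_pos sin_gt_zero) auto
      then show ?thesis by (simp only: p_def sin_minus minus_mult_minus)
    qed
    ultimately show ?thesis by (simp add: divide_nonpos_pos)
  next
    case False
    then have "d * cot d \<le> m * cot m"
      unfolding even using d dpi m by (intro x_cot_x_decreasing) auto
    moreover have "0 < sin (m + d) * sin (- (m - d))"
      using False a b d by (intro mult_pos_pos sin_gt_zero) auto
    then have "p < 0" unfolding p_def by (simp only: sin_minus)
    ultimately show ?thesis by (simp add: divide_nonneg_neg)
  qed
  then have "2 * (sin d)\<^sup>2 * ((m * cot m - d * cot d) / p) \<le> 0"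
    by (intro mult_nonneg_nonpos) auto
  with key show ?thesis by linarith
qed

text \<open>
At its jump the sawtooth is given the mean of its one-sided limits, 0. This keeps the data odd, so that
the interpolant has no component of frequency \<open>n\<close>.
\<close>

definition sawtooth_node :: "nat \<Rightarrow> nat \<Rightarrow> real" where
  "sawtooth_node n m = (if m = 0 then 0 else (pi - real m * (pi / real n)) / 2)"

definition sawtooth_interp :: "nat \<Rightarrow> real \<Rightarrow> real" where
  "sawtooth_interp n t = (\<Sum>m<2*n. sawtooth_node n m * dirichlet_kernel n (t - real m * (pi / real n))) / (2 * real n)"

lemma sawtooth_interp_trig_poly: "0 < n \<Longrightarrow> sawtooth_interp n \<in> trig_polys (n - 1)"
proof -
  assume "0 < n"
  then have "(\<lambda>t. 1 / (2 * real n) * (\<Sum>m<2*n. sawtooth_node n m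
      * dirichlet_kernel n (t - real m * (pi / real n)))) \<in> trig_polys (n - 1)"
    by (intro trig_polys_scale trig_polys_sum dirichlet_kernel_shift_trig_poly)
  then show ?thesis by (simp add: sawtooth_interp_def[abs_def])
qed

lemma alternating_sum_id: "(\<Sum>m<2*n. (-1) ^ m * real m) = - real n"
  by (induction n) auto

lemma alternating_sum_one: "(\<Sum>m<2*n. (-1) ^ m) = (0::real)"
  by (induction n) auto

text \<open>
The alternating sum of the sawtooth over shifted nodes does not depend on the shift; it is the value that the mean error
inherits in the end.
\<close>

lemma alternating_sum_sawtooth:
  assumes "0 < n"
  shows "(\<Sum>j<2*n. (-1) ^ j * ((pi - (real j * (pi / real n) + v)) / 2)) = pi / 2"
proof -
  have "(\<Sum>j<2*n. (-1) ^ j * ((pi - (real j * (pi / real n) + v)) / 2))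
     = (pi - v) / 2 * (\<Sum>j<2*n. (-1) ^ j) - pi / real n / 2 * (\<Sum>j<2*n. (-1) ^ j * real j)"
    unfolding sum_distrib_left sum_subtractf[symmetric]
    by (intro sum.cong refl) (simp add: field_simps)
  also have "\<dots> = pi / 2" unfolding alternating_sum_one alternating_sum_id using assms by simp
  finally show ?thesis .
qed

lemma alternating_sum_sawtooth_node:
  assumes "0 < n"
  shows "(\<Sum>m<2*n. (-1) ^ m * sawtooth_node n m) = 0"
proof -
  have "(\<Sum>m<2*n. (-1) ^ m * sawtooth_node n m)
      = (\<Sum>m<2*n. (-1) ^ m * ((pi - (real m * (pi / real n) + 0)) / 2) - (if m = 0 then pi / 2 else 0))"
    by (intro sum.cong refl) (simp add: sawtooth_node_def)
  also have "\<dots> = 0" unfolding sum_subtractf alternating_sum_sawtooth[OF assms] using assms by simp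
  finally show ?thesis .
qed

lemma alternating_sum_second_differences:
  fixes g :: "nat \<Rightarrow> real"
  shows "(\<Sum>m<2*N. (-1) ^ m * g m) - g 0 / 2 + g (2*N) / 2
     = (\<Sum>i<N. g (2*i) - 2 * g (2*i+1) + g (2*i+2)) / 2"
  by (induction N) (auto simp: field_simps)

text \<open>
The Lagrange kernels at the nodes sum to the constant \<open>2n\<close>, so the error is a combination of the kernels with the
coefficients \<open>(\<pi> - t)/2 - sawtooth_node n m\<close>. For \<open>m > 0\<close> the coefficient is \<open>- x m\<close>, and the kernel is
\<open>\<plusminus> sin (n t) cot (x m)\<close>. The node 0 carries the coefficient \<open>- (x 0 + x (2n))/2\<close>, since \<open>x (2n) = x 0 - \<pi>\<close>;
as the cotangent has period \<open>\<pi>\<close>, this node splits evenly into the two ends of a trapezoidal alternating sum, which consists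
of second differences.
\<close>

lemma sawtooth_error_formula:
  fixes n :: nat and t :: real
  defines "x \<equiv> \<lambda>m. (t - real m * (pi / real n)) / 2"
  assumes n: "0 < n" and ns: "\<And>m. m < 2 * n \<Longrightarrow> sin (x m) \<noteq> 0"
  shows "2 * real n * ((pi - t) / 2 - sawtooth_interp n t)
    = - sin (real n * t) / 2 * (\<Sum>i<n. x (2*i) * cot (x (2*i)) - 2 * (x (2*i+1) * cot (x (2*i+1)))
            + x (2*i+2) * cot (x (2*i+2)))"
proof -
  define \<theta> where "\<theta> = pi / real n"
  have nth: "real n * \<theta> = pi" using n by (simp add: \<theta>_def)
  define K where "K m = dirichlet_kernel n (t - real m * \<theta>) + cos (real n * (t - real m * \<theta>))" for m
  have cosn: "cos (real n * (t - real m * \<theta>)) = (-1) ^ m * cos (real n * t)"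
   and sinn: "sin (real n * (t - real m * \<theta>)) = (-1) ^ m * sin (real n * t)" for m
  proof -
    have e: "real n * (t - real m * \<theta>) = real n * t - real m * pi"
      by (simp add: algebra_simps flip: nth)
    show "cos (real n * (t - real m * \<theta>)) = (-1) ^ m * cos (real n * t)"
      "sin (real n * (t - real m * \<theta>)) = (-1) ^ m * sin (real n * t)"
      unfolding e by (simp_all add: cos_diff sin_diff)
  qed
  have "2 * real n * sawtooth_interp n t = (\<Sum>m<2*n. sawtooth_node n m * dirichlet_kernel n (t - real m * \<theta>))"
    using n by (simp add: sawtooth_interp_def \<theta>_def)
  also have "\<dots> = (\<Sum>m<2*n. sawtooth_node n m * K m)
       - cos (real n * t) * (\<Sum>m<2*n. (-1) ^ m * sawtooth_node n m)"
    unfolding sum_distrib_left sum_subtractf[symmetric]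
    unfolding K_def cosn by (intro sum.cong refl) (simp add: algebra_simps)
  also have "\<dots> = (\<Sum>m<2*n. sawtooth_node n m * K m)"
    by (simp add: alternating_sum_sawtooth_node[OF n])
  finally have "2 * real n * ((pi - t) / 2 - sawtooth_interp n t)
      = (pi - t) / 2 * (\<Sum>m<2*n. K m) - (\<Sum>m<2*n. sawtooth_node n m * K m)"
    using sum_dirichlet_nodes[OF n, of t] by (simp add: K_def \<theta>_def algebra_simps)
  also have "\<dots> = (\<Sum>m<2*n. ((pi - t) / 2 - sawtooth_node n m) * K m)"
    by (simp add: sum_distrib_left sum_subtractf[symmetric] algebra_simps)
  also have "\<dots> = (\<Sum>m<2*n. - sin (real n * t) * ((-1) ^ m * (x m * cot (x m)))
         + (if m = 0 then pi / 2 * sin (real n * t) * cot (x 0) else 0))"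
  proof (intro sum.cong refl)
    fix m assume "m \<in> {..<2*n}"
    then have s: "sin ((t - real m * \<theta>) / 2) \<noteq> 0" using ns by (simp add: x_def \<theta>_def)
    have K: "K m = (-1) ^ m * sin (real n * t) * cot (x m)"
      unfolding K_def dirichlet_kernel_plus_cos[OF s] sinn by (simp add: x_def \<theta>_def)
    have node: "(pi - t) / 2 - sawtooth_node n m = - x m + (if m = 0 then pi / 2 else 0)"
      by (simp add: sawtooth_node_def x_def field_simps)
    show "((pi - t) / 2 - sawtooth_node n m) * K m
       = - sin (real n * t) * ((-1) ^ m * (x m * cot (x m)))
         + (if m = 0 then pi / 2 * sin (real n * t) * cot (x 0) else 0)"
      unfolding K node by (simp add: algebra_simps)
  qed
  also have "\<dots> = - sin (real n * t) * ((\<Sum>m<2*n. (-1) ^ m * (x m * cot (x m))) - pi / 2 * cot (x 0))"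
    unfolding sum.distrib sum_distrib_left[symmetric] using n by (simp add: right_diff_distrib)
  also have "pi / 2 * cot (x 0) = x 0 * cot (x 0) / 2 - x (2*n) * cot (x (2*n)) / 2"
  proof -
    have e: "x (2*n) = x 0 - pi" using n by (simp add: x_def field_simps)
    have c: "cot (x (2*n)) = cot (x 0)" unfolding e cot_def by (simp add: cos_diff sin_diff)
    show ?thesis unfolding c unfolding e by (simp add: field_simps)
  qed
  also have "(\<Sum>m<2*n. (-1) ^ m * (x m * cot (x m))) - (x 0 * cot (x 0) / 2 - x (2*n) * cot (x (2*n)) / 2)
     = (\<Sum>i<n. x (2*i) * cot (x (2*i)) - 2 * (x (2*i+1) * cot (x (2*i+1)))
            + x (2*i+2) * cot (x (2*i+2))) / 2"
    using alternating_sum_second_differences[where g = "\<lambda>m. x m * cot (x m)" and N = n] by linarith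
  finally show ?thesis by simp
qed

text \<open>
Between two nodes all the points \<open>x m\<close>, \<open>0 \<le> m \<le> 2n\<close>, lie in \<open>(-\<pi>, \<pi>)\<close> and avoid 0, so concavity makes each second
difference in the error formula nonpositive.
\<close>

lemma sawtooth_error_sign:
  assumes n: "0 < n" and j: "j < 2 * n" and v: "0 < v" "v < pi / real n"
  shows "0 \<le> (-1) ^ j * ((pi - (real j * (pi / real n) + v)) / 2
             - sawtooth_interp n (real j * (pi / real n) + v))"
proof -
  define \<theta> where "\<theta> = pi / real n"
  define t where "t = real j * \<theta> + v"
  define x where "x m = (t - real m * (pi / real n)) / 2" for m
  define S where "S = (\<Sum>i<n. x (2*i) * cot (x (2*i)) - 2 * (x (2*i+1) * cot (x (2*i+1)))
            + x (2*i+2) * cot (x (2*i+2)))"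
  have nth: "real n * \<theta> = pi" and th: "\<theta> > 0" using n by (auto simp: \<theta>_def)
  have xe: "2 * x m = (real j - real m) * \<theta> + v" for m
  proof -
    have "2 * x m = t - real m * \<theta>" by (simp add: x_def \<theta>_def)
    then show ?thesis by (simp add: t_def left_diff_distrib)
  qed
  have xne: "x m \<noteq> 0" for m
  proof (cases "m \<le> j")
    case True
    then have "0 \<le> (real j - real m) * \<theta>" using th by simp
    with xe[of m] v show ?thesis by auto
  next
    case False
    then have "(real j - real m) * \<theta> \<le> (-1) * \<theta>" using th by (intro mult_right_mono) auto
    with xe[of m] v show ?thesis by (auto simp: \<theta>_def)
  qed
  have xlt: "\<bar>x m\<bar> < pi" if "m \<le> 2 * n" for m
  proof -
    have "(real j - real m) * \<theta> \<le> (2 * real n - 1) * \<theta>"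
      using th j by (intro mult_right_mono) auto
    moreover have "(- (2 * real n)) * \<theta> \<le> (real j - real m) * \<theta>"
      using th that by (intro mult_right_mono) auto
    ultimately show ?thesis using xe[of m] v nth by (simp add: algebra_simps \<theta>_def[symmetric])
  qed
  have "sin (x m) \<noteq> 0" if "m < 2 * n" for m
    using xne[of m] xlt[of m] that sin_gt_zero[of "x m"] sin_gt_zero[of "- x m"]
    by (cases "x m > 0") auto
  then have F: "2 * real n * ((pi - t) / 2 - sawtooth_interp n t) = - sin (real n * t) / 2 * S"
    unfolding S_def x_def using n by (intro sawtooth_error_formula) auto
  have "S \<le> 0" unfolding S_def
  proof (rule sum_nonpos)
    fix i assume i: "i \<in> {..<n}"
    define m d where "m = x (2*i+1)" and "d = \<theta> / 2"
    have e: "x (2*i) = m + d" "x (2*i+2) = m - d"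
      by (simp_all add: x_def m_def d_def \<theta>_def algebra_simps add_divide_distrib diff_divide_distrib)
    have "\<bar>x (2*i)\<bar> < pi" "\<bar>x (2*i+2)\<bar> < pi" using i by (auto intro!: xlt)
    then have "(m + d) * cot (m + d) + (m - d) * cot (m - d) \<le> 2 * (m * cot m)"
      using xne[of "2*i"] xne[of "2*i+2"] xne[of "2*i+1"] th unfolding e m_def[symmetric]
      by (intro x_cot_x_midpoint_concave) (simp_all add: d_def)
    then show "x (2*i) * cot (x (2*i)) - 2 * (x (2*i+1) * cot (x (2*i+1)))
            + x (2*i+2) * cot (x (2*i+2)) \<le> 0"
      unfolding e m_def[symmetric] by linarith
  qed
  moreover have "sin (real n * t) = (-1) ^ j * sin (real n * v)"
  proof -
    have "real n * t = real j * pi + real n * v" by (simp add: t_def algebra_simps flip: nth)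
    then show ?thesis by (simp add: sin_add)
  qed
  moreover have "0 \<le> sin (real n * v)"
    using v n by (intro sin_ge_zero) (auto simp: field_simps)
  ultimately have "0 \<le> (-1) ^ j * (- sin (real n * t) / 2 * S)"
    by (simp add: mult_nonneg_nonpos flip: mult.assoc power_add)
  then have "0 \<le> 2 * real n * ((-1) ^ j * ((pi - t) / 2 - sawtooth_interp n t))"
    unfolding F[symmetric] by (simp add: mult_ac)
  then show ?thesis using n by (simp add: t_def \<theta>_def zero_le_mult_iff)
qed

text \<open>
The absolute values only insert the sign \<open>(-1)\<^sup>j\<close>, which removes the interpolant and leaves the alternating sum of the
sawtooth.
\<close>

lemma sawtooth_error_sum:
  assumes n: "0 < n" and v: "0 < v" "v < pi / real n"
  shows "(\<Sum>j<2*n. \<bar>(pi - (real j * (pi / real n) + v)) / 2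
             - sawtooth_interp n (real j * (pi / real n) + v)\<bar>) = pi / 2"
proof -
  have "(\<Sum>j<2*n. \<bar>(pi - (real j * (pi / real n) + v)) / 2
             - sawtooth_interp n (real j * (pi / real n) + v)\<bar>)
      = (\<Sum>j<2*n. (-1) ^ j * ((pi - (real j * (pi / real n) + v)) / 2)
             - (-1) ^ j * sawtooth_interp n (real j * (pi / real n) + v))"
  proof (intro sum.cong refl)
    fix j assume "j \<in> {..<2*n}"
    then have "0 \<le> (-1) ^ j * ((pi - (real j * (pi / real n) + v)) / 2
             - sawtooth_interp n (real j * (pi / real n) + v))"
      using sawtooth_error_sign[OF n _ v] by simp
    moreover have "\<bar>y - z\<bar> = (-1) ^ j * y - (-1) ^ j * z" if "0 \<le> (-1) ^ j * (y - z)" for y z :: real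
    proof -
      have "\<bar>y - z\<bar> = \<bar>(-1) ^ j * (y - z)\<bar>" by (simp add: abs_mult)
      also have "\<dots> = (-1) ^ j * (y - z)" using that by (rule abs_of_nonneg)
      finally show ?thesis by (simp add: right_diff_distrib)
    qed
    ultimately show "\<bar>(pi - (real j * (pi / real n) + v)) / 2
             - sawtooth_interp n (real j * (pi / real n) + v)\<bar>
      = (-1) ^ j * ((pi - (real j * (pi / real n) + v)) / 2)
             - (-1) ^ j * sawtooth_interp n (real j * (pi / real n) + v)" by blast
  qed
  also have "\<dots> = pi / 2"
    unfolding sum_subtractf alternating_sum_sawtooth[OF n]
      trig_poly_alternating_sum[OF sawtooth_interp_trig_poly[OF n] n] by simp
  finally show ?thesis .
qed

section \<open>The Favard inequality\<close>

lemma antiderivative_on_UNIV: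
  fixes f :: "real \<Rightarrow> real"
  assumes "continuous_on UNIV f"
  obtains F where "\<And>x. (F has_real_derivative f x) (at x)"
proof -
  have "isCont f x" for x using assms by (simp add: continuous_on_eq_continuous_at)
  then obtain F where "\<And>x. (F has_vector_derivative f x) (at x)"
    using einterval_antiderivative[of "-\<infinity>" "\<infinity>" f] by auto
  then show ?thesis using that by (auto simp: has_real_derivative_iff_has_vector_derivative)
qed

lemma has_integral_of_derivative:
  fixes F f :: "real \<Rightarrow> real"
  assumes "a \<le> b" "\<And>x. (F has_real_derivative f x) (at x)"
  shows "(f has_integral (F b - F a)) {a..b}"
proof (rule fundamental_theorem_of_calculus[OF assms(1)])
  fix x show "(F has_vector_derivative f x) (at x within {a..b})"
    using assms(2) has_real_derivative_iff_has_vector_derivative has_vector_derivative_at_within by blast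
qed

lemmas integral_of_derivative = integral_unique[OF has_integral_of_derivative]

lemma periodic_C_reflect: "f \<in> periodic_C \<Longrightarrow> (\<lambda>s. f (x - s)) \<in> periodic_C"
proof -
  assume f: "f \<in> periodic_C"
  have "f (x - (s + 2 * pi)) = f (x - s)" for s
    using f periodic_shift_int[of f "2*pi" "x - s" "-1"]
    by (simp add: periodic_C_def algebra_simps)
  moreover have "continuous_on UNIV (\<lambda>s. f (x - s))"
    using f by (auto simp: periodic_C_def intro!: continuous_on_compose2[of UNIV f] continuous_intros)
  ultimately show ?thesis by (simp add: periodic_C_def)
qed

text \<open>
In terms of an antiderivative \<open>F\<close> both sides are increments of \<open>F\<close> over a full period, and such increments
do not depend on the starting point because their derivative is zero.
\<close>

lemma integral_periodic_reflect:
  assumes "f \<in> periodic_C"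
  shows "integral {0..2*pi} (\<lambda>s. f (x - s)) = integral {0..2*pi} f"
proof -
  have "continuous_on UNIV f" using assms by (simp add: periodic_C_def)
  then obtain F where F: "\<And>x. (F has_real_derivative f x) (at x)"
    using antiderivative_on_UNIV by blast
  have F': "((\<lambda>s. F (u s)) has_real_derivative f (u s) * u') (at s)"
    if "(u has_real_derivative u') (at s)" for u u' s
    using DERIV_chain2[OF F that] .
  have "((\<lambda>a. F (a + 2 * pi) - F a) has_real_derivative 0) (at a)" for a
    using assms by (auto intro!: derivative_eq_intros F F' simp: periodic_C_def)
  then have const: "F (a + 2 * pi) - F a = F (b + 2 * pi) - F b" for a b
    using DERIV_isconst_all[of "\<lambda>a. F (a + 2 * pi) - F a" a b] by simp
  have "integral {0..2*pi} (\<lambda>s. f (x - s)) = - F (x - 2*pi) - (- F (x - 0))"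
    by (rule integral_of_derivative) (auto intro!: derivative_eq_intros F')
  also have "\<dots> = F (0 + 2*pi) - F 0" using const[of "x - 2*pi" 0] by simp
  also have "\<dots> = integral {0..2*pi} f"
    using integral_of_derivative[OF _ F, of 0 "2*pi"] by simp
  finally show ?thesis .
qed

lemma trig_poly_convolution:
  assumes D: "continuous_on {0..2*pi} D" and \<sigma>: "\<sigma> \<in> trig_polys m"
  shows "(\<lambda>x. integral {0..2*pi} (\<lambda>t. D t * \<sigma> (x - t))) \<in> trig_polys m"
proof -
  obtain a b where ab:
    "\<And>x. \<sigma> x = (\<Sum>k\<le>m. a k * cos (0 + real k * x) + b k * cos (- (pi/2) + real k * x))"
    using trig_polys_cases[OF \<sigma>] by blast
  have single: "((\<lambda>t. D t * cos (c + real k * (x - t))) has_integral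
      (integral {0..2*pi} (\<lambda>t. D t * cos (real k * t)) * cos (c + real k * x)
       + integral {0..2*pi} (\<lambda>t. D t * sin (real k * t)) * cos ((c - pi/2) + real k * x))) {0..2*pi}" for c k x
  proof -
    have "(\<lambda>t. D t * cos (c + real k * (x - t))) = (\<lambda>t. D t * cos (real k * t) * cos (c + real k * x)
         + D t * sin (real k * t) * cos ((c - pi/2) + real k * x))"
    proof
      fix t
      have "cos (c + real k * (x - t)) = cos ((c + real k * x) - real k * t)"
        by (simp add: algebra_simps)
      moreover have "cos ((c - pi/2) + real k * x) = sin (c + real k * x)"
      proof -
        have "(c - pi/2) + real k * x = (c + real k * x) - pi/2" by simp
        then show ?thesis by (simp only: cos_diff) simp
      qed
      ultimately show "D t * cos (c + real k * (x - t)) = D t * cos (real k * t) * cos (c + real k * x)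
         + D t * sin (real k * t) * cos ((c - pi/2) + real k * x)"
        by (simp add: cos_diff algebra_simps)
    qed
    then show ?thesis
      by (simp only:) (intro has_integral_add has_integral_mult_left integrable_integral
          integrable_continuous_interval continuous_intros D)
  qed
  have "((\<lambda>t. \<Sum>k\<le>m. a k * (D t * cos (0 + real k * (x - t))) + b k * (D t * cos (- (pi/2) + real k * (x - t))))
     has_integral (\<Sum>k\<le>m.
        a k * (integral {0..2*pi} (\<lambda>t. D t * cos (real k * t)) * cos (0 + real k * x)
       + integral {0..2*pi} (\<lambda>t. D t * sin (real k * t)) * cos ((0 - pi/2) + real k * x))
      + b k * (integral {0..2*pi} (\<lambda>t. D t * cos (real k * t)) * cos (- (pi/2) + real k * x)
       + integral {0..2*pi} (\<lambda>t. D t * sin (real k * t)) * cos ((- (pi/2) - pi/2) + real k * x)))) {0..2*pi}" for x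
    by (intro has_integral_sum has_integral_add has_integral_mult_right single) auto
  moreover have "(\<lambda>t. D t * \<sigma> (x - t)) = (\<lambda>t. \<Sum>k\<le>m. a k * (D t * cos (0 + real k * (x - t)))
      + b k * (D t * cos (- (pi/2) + real k * (x - t))))" for x
    unfolding ab sum_distrib_left by (intro ext sum.cong refl) (simp add: algebra_simps)
  ultimately have e: "integral {0..2*pi} (\<lambda>t. D t * \<sigma> (x - t)) = (\<Sum>k\<le>m.
        a k * (integral {0..2*pi} (\<lambda>t. D t * cos (real k * t)) * cos (0 + real k * x)
       + integral {0..2*pi} (\<lambda>t. D t * sin (real k * t)) * cos ((0 - pi/2) + real k * x))
      + b k * (integral {0..2*pi} (\<lambda>t. D t * cos (real k * t)) * cos (- (pi/2) + real k * x)
       + integral {0..2*pi} (\<lambda>t. D t * sin (real k * t)) * cos ((- (pi/2) - pi/2) + real k * x)))" for x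
    by (simp only: integral_unique)
  show ?thesis unfolding e
    by (intro trig_polys_sum trig_polys_add trig_polys_scale trig_polys_cos) auto
qed

lemma integral_blocks:
  fixes f :: "real \<Rightarrow> real"
  assumes "continuous_on UNIV f" "0 \<le> \<theta>"
  shows "integral {0..real N * \<theta>} f = integral {0..\<theta>} (\<lambda>v. \<Sum>j<N. f (real j * \<theta> + v))"
proof -
  obtain F where F: "\<And>x. (F has_real_derivative f x) (at x)"
    using antiderivative_on_UNIV[OF assms(1)] by blast
  have F': "((\<lambda>s. F (u s)) has_real_derivative f (u s) * u') (at s)"
    if "(u has_real_derivative u') (at s)" for u u' s
    using DERIV_chain2[OF F that] .
  have "integral {0..\<theta>} (\<lambda>v. \<Sum>j<N. f (real j * \<theta> + v))
      = (\<Sum>j<N. F (real j * \<theta> + \<theta>)) - (\<Sum>j<N. F (real j * \<theta> + 0))"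
    by (rule integral_of_derivative[OF assms(2)]) (auto intro!: derivative_eq_intros F')
  also have "\<dots> = (\<Sum>j<N. F (real (Suc j) * \<theta>) - F (real j * \<theta>))"
    by (simp add: sum_subtractf algebra_simps)
  also have "\<dots> = F (real N * \<theta>) - F 0"
    using sum_lessThan_telescope[of "\<lambda>j. F (real j * \<theta>)" N] by simp
  also have "\<dots> = integral {0..real N * \<theta>} f"
    using integral_of_derivative[OF _ F, of 0 "real N * \<theta>"] assms(2) by simp
  finally show ?thesis by simp
qed

text \<open>
Cutting the period into the \<open>2n\<close> arcs between nodes and superposing them turns the integrand into the constant \<open>\<pi>/2\<close>
on an arc of length \<open>\<pi>/n\<close>.
\<close>

lemma integral_sawtooth_error:
  assumes n: "0 < n"
  shows "integral {0..2*pi} (\<lambda>t. \<bar>(pi - t) / 2 - sawtooth_interp n t\<bar>) = pi\<^sup>2 / (2 * real n)"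
proof -
  define \<theta> where "\<theta> = pi / real n"
  have cont: "continuous_on UNIV (sawtooth_interp n)"
    using trig_polys_periodic_C[OF sawtooth_interp_trig_poly[OF n]] by (simp add: periodic_C_def)
  have "2 * pi = real (2 * n) * \<theta>" using n by (simp add: \<theta>_def)
  then have "integral {0..2*pi} (\<lambda>t. \<bar>(pi - t) / 2 - sawtooth_interp n t\<bar>)
    = integral {0..\<theta>} (\<lambda>v. \<Sum>j<2*n. \<bar>(pi - (real j * \<theta> + v)) / 2 - sawtooth_interp n (real j * \<theta> + v)\<bar>)"
    by (simp only:, intro integral_blocks) (auto intro!: continuous_intros cont simp: \<theta>_def)
  also have "\<dots> = integral {0<..<\<theta>} (\<lambda>v. \<Sum>j<2*n. \<bar>(pi - (real j * \<theta> + v)) / 2 - sawtooth_interp n (real j * \<theta> + v)\<bar>)"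
    by (rule integral_open_interval_real)
  also have "\<dots> = integral {0<..<\<theta>} (\<lambda>v. pi / 2)"
    by (intro integral_cong) (simp only: \<theta>_def greaterThanLessThan_iff sawtooth_error_sum[OF n])
  also have "\<dots> = integral {0..\<theta>} (\<lambda>v. pi / 2)" by (rule integral_open_interval_real[symmetric])
  also have "\<dots> = pi\<^sup>2 / (2 * real n)"
    using n by (simp add: \<theta>_def power2_eq_square)
  finally show ?thesis .
qed

text \<open>
Replacing the sawtooth kernel by its interpolant in \<open>(sawtooth) * g'\<close> leaves the convolution of \<open>g'\<close> with the error \<open>D\<close>
of the interpolant. In it \<open>g'\<close> may be replaced by \<open>g' - \<sigma>\<close>, since \<open>D\<close> convolved with \<open>\<sigma>\<close> is again a trigonometric
polynomial. This form, with the error of \<open>g'\<close> instead of its norm, can be iterated.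
\<close>

lemma favard_inequality:
  assumes n: "0 < n" and g: "g \<in> periodic_C" and g': "g' \<in> periodic_C"
    and deriv: "\<And>x. (g has_real_derivative g' x) (at x)"
    and \<sigma>: "\<sigma> \<in> trig_polys (n - 1)" and M: "\<And>x. \<bar>g' x - \<sigma> x\<bar> \<le> M"
  shows "\<exists>\<tau>\<in>trig_polys (n - 1). \<forall>x. \<bar>g x - \<tau> x\<bar> \<le> pi / (2 * real n) * M"
proof -
  define s where "s = sawtooth_interp n"
  define D where "D t = (pi - t) / 2 - s t" for t
  define C where "C = integral {0..2*pi} g"
  have s: "s \<in> trig_polys (n - 1)" unfolding s_def by (rule sawtooth_interp_trig_poly[OF n])
  have contUNIV: "continuous_on UNIV f" if "f \<in> periodic_C" for f using that by (simp add: periodic_C_def)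
  have cont: "continuous_on S f" if "f \<in> periodic_C" for f S
    using contUNIV[OF that] continuous_on_subset by blast
  have cont_refl: "continuous_on S (\<lambda>t. f (x - t))" if "f \<in> periodic_C" for f S x
    using cont[OF periodic_C_reflect[OF that]] .
  have sC: "s \<in> periodic_C" and \<sigma>C: "\<sigma> \<in> periodic_C" using s \<sigma> trig_polys_periodic_C by blast+
  have contD: "continuous_on S D" for S
    unfolding D_def[abs_def] by (intro continuous_intros cont sC) auto
  have deriv': "((\<lambda>t. g (u t)) has_real_derivative g' (u t) * u') (at t)"
    if "(u has_real_derivative u') (at t)" for u u' t
    using DERIV_chain2[OF deriv that] .
  define E where "E x = integral {0..2*pi} (\<lambda>t. D t * (g' (x - t) - \<sigma> (x - t)))" for x
  define \<tau> where "\<tau> x = 1 / pi * (integral {0..2*pi} (\<lambda>t. s t * g' (x - t))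
       + integral {0..2*pi} (\<lambda>t. D t * \<sigma> (x - t)) + C / 2)" for x
  have rep: "pi * g x = integral {0..2*pi} (\<lambda>t. (pi - t) / 2 * g' (x - t)) + C / 2" for x
  proof -
    have "integral {0..2*pi} (\<lambda>t. g (x - t) / 2 + (pi - t) / 2 * g' (x - t))
        = - ((pi - 2*pi) / 2 * g (x - 2*pi)) - (- ((pi - 0) / 2 * g (x - 0)))"
      by (rule integral_of_derivative) (auto intro!: derivative_eq_intros deriv' simp: field_simps)
    also have "g (x - 2*pi) = g x"
      using periodic_shift_int[of g "2*pi" x "-1"] g by (simp add: periodic_C_def)
    finally have "integral {0..2*pi} (\<lambda>t. g (x - t) / 2 + (pi - t) / 2 * g' (x - t)) = pi * g x"
      by (simp add: field_simps)
    moreover have "integral {0..2*pi} (\<lambda>t. g (x - t) / 2 + (pi - t) / 2 * g' (x - t))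
        = integral {0..2*pi} (\<lambda>t. g (x - t) / 2) + integral {0..2*pi} (\<lambda>t. (pi - t) / 2 * g' (x - t))"
      by (intro integral_add integrable_continuous_interval continuous_intros cont_refl g g') auto
    moreover have "integral {0..2*pi} (\<lambda>t. g (x - t) / 2) = C / 2"
      using integral_periodic_reflect[OF g, of x] by (simp add: C_def)
    ultimately show ?thesis by simp
  qed
  have split: "integral {0..2*pi} (\<lambda>t. (pi - t) / 2 * g' (x - t))
     = integral {0..2*pi} (\<lambda>t. s t * g' (x - t)) + integral {0..2*pi} (\<lambda>t. D t * \<sigma> (x - t)) + E x" for x
  proof -
    have "integral {0..2*pi} (\<lambda>t. (pi - t) / 2 * g' (x - t))
       = integral {0..2*pi} (\<lambda>t. (s t * g' (x - t) + D t * \<sigma> (x - t)) + D t * (g' (x - t) - \<sigma> (x - t)))"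
      by (intro integral_cong) (simp add: D_def algebra_simps)
    also have "\<dots> = integral {0..2*pi} (\<lambda>t. s t * g' (x - t) + D t * \<sigma> (x - t)) + E x"
      unfolding E_def
      by (intro integral_add integrable_continuous_interval continuous_intros cont_refl cont contD sC \<sigma>C g')
    also have "integral {0..2*pi} (\<lambda>t. s t * g' (x - t) + D t * \<sigma> (x - t))
      = integral {0..2*pi} (\<lambda>t. s t * g' (x - t)) + integral {0..2*pi} (\<lambda>t. D t * \<sigma> (x - t))"
      by (intro integral_add integrable_continuous_interval continuous_intros cont_refl cont contD sC \<sigma>C g')
    finally show ?thesis .
  qed
  \<comment> \<open>By periodicity the translate may be moved from \<open>g'\<close> to the trigonometric factor.\<close>
  have "(\<lambda>x. integral {0..2*pi} (\<lambda>t. s t * g' (x - t))) = (\<lambda>x. integral {0..2*pi} (\<lambda>t. g' t * s (x - t)))"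
  proof
    fix x
    have "(\<lambda>t. g' t * s (x - t)) \<in> periodic_C"
      using g' periodic_C_reflect[OF sC, of x] by (auto simp: periodic_C_def intro!: continuous_intros)
    from integral_periodic_reflect[OF this, of x]
    show "integral {0..2*pi} (\<lambda>t. s t * g' (x - t)) = integral {0..2*pi} (\<lambda>t. g' t * s (x - t))"
      by (simp add: mult.commute)
  qed
  then have conv: "(\<lambda>x. integral {0..2*pi} (\<lambda>t. s t * g' (x - t))) \<in> trig_polys (n - 1)"
    using trig_poly_convolution[OF cont[OF g'] s] by simp
  have "\<tau> \<in> trig_polys (n - 1)"
    unfolding \<tau>_def[abs_def]
    by (intro trig_polys_scale trig_polys_add trig_polys_const conv trig_poly_convolution contD \<sigma>)
  moreover have "\<bar>g x - \<tau> x\<bar> \<le> pi / (2 * real n) * M" for x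
  proof -
    have "\<bar>E x\<bar> \<le> integral {0..2*pi} (\<lambda>t. \<bar>D t\<bar> * M)"
      unfolding E_def real_norm_def[symmetric]
      by (intro integral_norm_bound_integral integrable_continuous_interval continuous_intros
           cont_refl contD \<sigma>C g') (auto simp: abs_mult intro!: mult_left_mono M)
    also have "\<dots> = pi\<^sup>2 / (2 * real n) * M"
      using integral_sawtooth_error[OF n] by (simp add: D_def s_def)
    finally have "\<bar>E x\<bar> \<le> pi\<^sup>2 / (2 * real n) * M" .
    moreover have "pi * (g x - \<tau> x) = E x"
      using rep[of x] split[of x] by (simp add: \<tau>_def algebra_simps)
    ultimately have "\<bar>pi * (g x - \<tau> x)\<bar> \<le> pi * (pi / (2 * real n) * M)"
      by (simp add: power2_eq_square)
    then have "pi * \<bar>g x - \<tau> x\<bar> \<le> pi * (pi / (2 * real n) * M)"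
      by (simp only: abs_mult abs_of_pos pi_gt_zero)
    then show ?thesis by (rule mult_left_le_imp_le) (rule pi_gt_zero)
  qed
  ultimately show ?thesis by blast
qed

section \<open>Smoothing by symmetric differences\<close>

lemma fin_diff_zero_step: "0 < r \<Longrightarrow> fin_diff r 0 f x = 0"
  using fin_diff_Suc[of "r - 1" 0 f x] by simp

lemma sum_symmetric_about:
  fixes G :: "nat \<Rightarrow> real"
  assumes "d \<le> m"
  shows "sum G {m - d..m + d} = G m + (\<Sum>i=1..d. G (m + i) + G (m - i))"
  using assms
proof (induction d)
  case (Suc d)
  have eq: "{m - Suc d..m + Suc d} = insert (m - Suc d) (insert (m + Suc d) {m - d..m + d})"
    using Suc.prems by auto
  have n1: "m - Suc d \<notin> insert (m + Suc d) {m - d..m + d}" and n2: "m + Suc d \<notin> {m - d..m + d}"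
    using Suc.prems by auto
  have "sum G {m - Suc d..m + Suc d} = G (m - Suc d) + sum G (insert (m + Suc d) {m - d..m + d})"
    unfolding eq by (rule sum.insert[OF _ n1]) simp
  also have "sum G (insert (m + Suc d) {m - d..m + d}) = G (m + Suc d) + sum G {m - d..m + d}"
    by (rule sum.insert[OF _ n2]) simp
  finally have "sum G {m - Suc d..m + Suc d} = G (m - Suc d) + (G (m + Suc d) + sum G {m - d..m + d})" .
  then show ?case using Suc by simp
qed simp

lemma fin_diff_even_centered:
  "(-1) ^ k * fin_diff (2*k) s f (x - real k * s)
   = real (2*k choose k) * f x
     + (\<Sum>i=1..k. (-1) ^ i * real (2*k choose (k + i)) * (f (x + real i * s) + f (x - real i * s)))"
proof -
  define G where "G j = (-1) ^ j * real (2*k choose j) * f (x - real k * s + real j * s)" for j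
  have G: "(-1) ^ k * G j = (-1) ^ i * real (2*k choose j) * f (x - real k * s + real j * s)"
    if "even (k + j + i)" for i j
    using that by (auto simp: G_def minus_one_power_iff)
  have "fin_diff (2*k) s f (x - real k * s) = sum G {k - k..k + k}"
    unfolding fin_diff_def G_def by (intro sum.cong) auto
  also have "\<dots> = G k + (\<Sum>i=1..k. G (k + i) + G (k - i))"
    by (rule sum_symmetric_about) simp
  finally have "(-1) ^ k * fin_diff (2*k) s f (x - real k * s)
      = (-1) ^ k * G k + (\<Sum>i=1..k. (-1) ^ k * (G (k + i) + G (k - i)))"
    by (simp add: distrib_left sum_distrib_left)
  also have "(-1) ^ k * G k = real (2*k choose k) * f x"
    using G[of k 0] by (simp add: G_def)
  also have "(\<Sum>i=1..k. (-1) ^ k * (G (k + i) + G (k - i)))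
     = (\<Sum>i=1..k. (-1) ^ i * real (2*k choose (k + i)) * (f (x + real i * s) + f (x - real i * s)))"
  proof (intro sum.cong refl)
    fix i assume i: "i \<in> {1..k}"
    have arg: "x - real k * s + real (k + i) * s = x + real i * s" by (simp add: algebra_simps)
    have "even (k + (k + i) + i)" by presburger
    from G[OF this] have 1: "(-1) ^ k * G (k + i) = (-1) ^ i * real (2*k choose (k + i)) * f (x + real i * s)"
      unfolding arg .
    have ev: "even (k + (k - i) + i)" using i by simp
    have sym: "(2*k choose (k - i)) = (2*k choose (k + i))"
      using binomial_symmetric[of "k - i" "2*k"] i by simp
    have arg': "x - real k * s + real (k - i) * s = x - real i * s"
      using i by (simp add: of_nat_diff left_diff_distrib)
    from G[OF ev] have 2: "(-1) ^ k * G (k - i) = (-1) ^ i * real (2*k choose (k + i)) * f (x - real i * s)"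
      unfolding arg' sym .
    show "(-1) ^ k * (G (k + i) + G (k - i))
      = (-1) ^ i * real (2*k choose (k + i)) * (f (x + real i * s) + f (x - real i * s))"
      using 1 2 by (simp add: distrib_left)
  qed
  finally show ?thesis .
qed

text \<open>
Splitting off the first term leaves the negative of a sum of the same kind for the shifted sequence, which lies between 0 and
\<open>b 1 \<le> b 0\<close>.
\<close>

lemma alternating_sum_decreasing:
  fixes b :: "nat \<Rightarrow> real"
  assumes "\<And>i. 0 \<le> b i" "\<And>i. b (Suc i) \<le> b i"
  shows "0 \<le> (\<Sum>i<k. (-1) ^ i * b i) \<and> (\<Sum>i<k. (-1) ^ i * b i) \<le> b 0"
  using assms
proof (induction k arbitrary: b)
  case (Suc k)
  have "(\<Sum>i<Suc k. (-1) ^ i * b i) = b 0 - (\<Sum>i<k. (-1) ^ i * b (Suc i))"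
    by (subst sum.lessThan_Suc_shift) (simp add: sum_negf)
  moreover have "0 \<le> (\<Sum>i<k. (-1) ^ i * b (Suc i)) \<and> (\<Sum>i<k. (-1) ^ i * b (Suc i)) \<le> b (Suc 0)"
    using Suc.IH[of "\<lambda>i. b (Suc i)"] Suc.prems by simp
  ultimately show ?case using Suc.prems(2)[of 0] by simp
qed simp

lemma sum_inverse_squares_le: "(\<Sum>i<k. 1 / (real (Suc i))\<^sup>2) \<le> 2"
proof -
  have "(\<Sum>i<Suc k. 1 / (real (Suc i))\<^sup>2) \<le> 2 - 1 / real (Suc k)" for k
  proof (induction k)
    case (Suc k)
    have "1 / (real (Suc (Suc k)))\<^sup>2 \<le> 1 / real (Suc k) - 1 / real (Suc (Suc k))"
    proof -
      have "1 / (a + 1)\<^sup>2 \<le> 1 / a - 1 / (a + 1)" if "0 < a" for a :: real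
      proof -
        have "1 / (a + 1)\<^sup>2 \<le> 1 / (a * (a + 1))"
          using that by (intro divide_left_mono) (auto simp: power2_eq_square)
        also have "\<dots> = 1 / a - 1 / (a + 1)" using that by (simp add: field_simps)
        finally show ?thesis .
      qed
      from this[of "real (Suc k)"] show ?thesis by (simp add: add_ac)
    qed
    then show ?case using Suc by simp
  qed simp
  from this[of k] have "(\<Sum>i<Suc k. 1 / (real (Suc i))\<^sup>2) \<le> 2"
    by (rule order_trans) simp
  moreover have "(\<Sum>i<k. 1 / (real (Suc i))\<^sup>2) \<le> (\<Sum>i<Suc k. 1 / (real (Suc i))\<^sup>2)" by simp
  ultimately show ?thesis by linarith
qed

text \<open>
Coefficients of the central difference of order \<open>2k\<close>, up to sign and relative to the one in the middle.
\<close>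

definition central_ratio :: "nat \<Rightarrow> nat \<Rightarrow> real" where
  "central_ratio k i = real (2*k choose (k + i)) / real (2*k choose k)"

lemma central_ratio_nonneg: "0 \<le> central_ratio k i"
  by (simp add: central_ratio_def)

lemma central_ratio_decreasing: "central_ratio k (Suc i) \<le> central_ratio k i"
proof -
  have "(2*k choose (k + Suc i)) \<le> (2*k choose (k + i))"
  proof (cases "k + Suc i \<le> 2 * k")
    case True
    then show ?thesis by (intro binomial_antimono) auto
  qed (simp add: binomial_eq_0)
  then show ?thesis unfolding central_ratio_def by (intro divide_right_mono) auto
qed

lemma central_ratio_le_1: "central_ratio k i \<le> 1"
proof (induction i)
  case 0 then show ?case by (simp add: central_ratio_def)
next
  case (Suc i) then show ?case using central_ratio_decreasing[of k i] by linarith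
qed

text \<open>
Index \<open>i\<close> belongs to the pair of points at distance \<open>i + 1\<close> steps. The weights are those for which the
central difference, divided by its middle coefficient, becomes \<open>f x\<close> minus half the weighted sum of the
values \<open>f (x + (i + 1) s) + f (x - (i + 1) s)\<close>.
\<close>

definition smoothing_weight :: "nat \<Rightarrow> nat \<Rightarrow> real" where
  "smoothing_weight k i = 2 * (-1) ^ i * central_ratio k (Suc i)"

text \<open>
The second differences carry the outer weights \<open>w i/(i + 1)\<^sup>2\<close> twice and the middle one, \<open>-2\<close> times their sum, once.
In the middle the alternating signs make the weights cancel, so that only the outer ones contribute a full series of
inverse squares. Bounding the middle by absolute values as well would give 8 instead of 6, and with it a smoothing
operator that the argument below no longer makes a contraction.
\<close>

lemma smoothing_weight_bound:
  "(\<Sum>i<k. \<bar>smoothing_weight k i\<bar> / (real (Suc i))\<^sup>2) + \<bar>\<Sum>i<k. smoothing_weight k i / (real (Suc i))\<^sup>2\<bar> \<le> 6"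
proof -
  define b where "b i = central_ratio k (Suc i) / (real (Suc i))\<^sup>2" for i
  have "(\<Sum>i<k. \<bar>smoothing_weight k i\<bar> / (real (Suc i))\<^sup>2) \<le> (\<Sum>i<k. 2 * (1 / (real (Suc i))\<^sup>2))"
    by (intro sum_mono) (simp add: smoothing_weight_def abs_mult central_ratio_le_1
        central_ratio_nonneg divide_right_mono del: of_nat_Suc)
  also have "\<dots> \<le> 4"
    unfolding sum_distrib_left[symmetric] using sum_inverse_squares_le[of k] by linarith
  finally have 1: "(\<Sum>i<k. \<bar>smoothing_weight k i\<bar> / (real (Suc i))\<^sup>2) \<le> 4" .
  have "0 \<le> (\<Sum>i<k. (-1) ^ i * b i) \<and> (\<Sum>i<k. (-1) ^ i * b i) \<le> b 0"
  proof (rule alternating_sum_decreasing)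
    fix i
    show "0 \<le> b i" by (simp add: b_def central_ratio_nonneg)
    show "b (Suc i) \<le> b i" unfolding b_def
      by (intro frac_le central_ratio_nonneg central_ratio_decreasing power_mono) auto
  qed
  moreover have "b 0 \<le> 1" using central_ratio_le_1 by (simp add: b_def)
  moreover have "(\<Sum>i<k. smoothing_weight k i / (real (Suc i))\<^sup>2) = 2 * (\<Sum>i<k. (-1) ^ i * b i)"
    by (simp add: sum_distrib_left smoothing_weight_def b_def algebra_simps)
  ultimately have "\<bar>\<Sum>i<k. smoothing_weight k i / (real (Suc i))\<^sup>2\<bar> \<le> 2" by simp
  with 1 show ?thesis by linarith
qed

text \<open>
Averaging \<open>f\<close> against a hat function of half-width \<open>s\<close> is a second difference of a second antiderivative: the Taylor
formula with integral remainder for \<open>F2\<close> in both directions, in which the first-order terms cancel.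
\<close>

lemma has_integral_second_difference:
  assumes F1: "\<And>x. (F1 has_real_derivative f x) (at x)"
    and F2: "\<And>x. (F2 has_real_derivative F1 x) (at x)"
    and s: "s \<noteq> 0"
  shows "((\<lambda>t. (1 - t) * (f (x + s * t) + f (x - s * t)))
           has_integral (F2 (x + s) - 2 * F2 x + F2 (x - s)) / s\<^sup>2) {0..1}"
proof -
  have F1': "((\<lambda>t. F1 (u t)) has_real_derivative f (u t) * u') (at t)"
    and F2': "((\<lambda>t. F2 (u t)) has_real_derivative F1 (u t) * u') (at t)"
    if "(u has_real_derivative u') (at t)" for u u' t
    using DERIV_chain2[OF F1 that] DERIV_chain2[OF F2 that] .
  have "((\<lambda>t. s\<^sup>2 * ((1 - t) * (f (x + s * t) + f (x - s * t)))) has_integral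
      (s * (1 - 1) * (F1 (x + s * 1) - F1 (x - s * 1)) + F2 (x + s * 1) + F2 (x - s * 1))
      - (s * (1 - 0) * (F1 (x + s * 0) - F1 (x - s * 0)) + F2 (x + s * 0) + F2 (x - s * 0))) {0..1}"
    by (rule has_integral_of_derivative)
      (auto intro!: derivative_eq_intros F1' F2' simp: algebra_simps power2_eq_square)
  note int = has_integral_mult_right[OF this, of "1 / s\<^sup>2"]
  have "1 / s\<^sup>2 * (s\<^sup>2 * y) = y" for y using s by simp
  moreover have "1 / s\<^sup>2 * ((s * (1 - 1) * (F1 (x + s * 1) - F1 (x - s * 1)) + F2 (x + s * 1) + F2 (x - s * 1))
      - (s * (1 - 0) * (F1 (x + s * 0) - F1 (x - s * 0)) + F2 (x + s * 0) + F2 (x - s * 0)))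
      = (F2 (x + s) - 2 * F2 x + F2 (x - s)) / s\<^sup>2" by simp
  ultimately show ?thesis using int by (simp only:)
qed

section \<open>The upper bound\<close>

text \<open>
The operator \<open>U\<close> of the proof takes weighted second differences with the steps \<open>s i\<close>. Applied to a second
antiderivative \<open>F2\<close> of \<open>f\<close> it gives the smoothed function, and its first two derivatives are \<open>U\<close> applied to \<open>F1\<close> and \<open>f\<close>.
So the Favard inequality, starting from the approximant \<open>U \<sigma>\<close> of \<open>U f\<close>, produces an approximant of \<open>U F2\<close>, and the
distance of \<open>f\<close> from \<open>U F2\<close> is an average of differences of order \<open>2k\<close>.
\<close>

lemma smoothing_step:
  assumes f: "f \<in> periodic_C" and n: "0 < n" and k: "0 < k"
    and \<sigma>: "\<sigma> \<in> trig_polys (n - 1)" and M: "\<And>x. \<bar>f x - \<sigma> x\<bar> \<le> M"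
  shows "best_approx (n - 1) f
     \<le> modulus_smoothness (2*k) f (2*pi / real n) / real (2*k choose k) + 3/4 * M"
proof -
  define h where "h = 2 * pi / real n"
  define \<omega> where "\<omega> = modulus_smoothness (2*k) f h"
  define C where "C = real (2*k choose k)"
  define w where "w = smoothing_weight k"
  define s where "s i = real (Suc i) * h" for i
  have h: "0 < h" using n by (simp add: h_def)
  have s: "0 < s i" for i using h by (simp add: s_def)
  have C: "0 < C" by (simp add: C_def)
  have fcont: "continuous_on UNIV f" and fper: "\<And>x. f (x + 2*pi) = f x"
    using f by (auto simp: periodic_C_def)
  obtain F1 where F1: "\<And>x. (F1 has_real_derivative f x) (at x)"
    using antiderivative_on_UNIV[OF fcont] by blast
  then have "continuous_on UNIV F1" by (meson DERIV_continuous_on has_field_derivative_at_within)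
  then obtain F2 where F2: "\<And>x. (F2 has_real_derivative F1 x) (at x)"
    using antiderivative_on_UNIV by blast
  define A where "A F i x = (F (x + s i) - 2 * F x + F (x - s i)) / (s i)\<^sup>2" for F :: "real \<Rightarrow> real" and i x
  define U where "U F x = (\<Sum>i<k. w i * A F i x)" for F x
  have U_deriv: "(U F has_real_derivative U F' x) (at x)"
    if F: "\<And>x. (F has_real_derivative F' x) (at x)" for F F' x
  proof -
    have F': "((\<lambda>t. F (u t)) has_real_derivative F' (u t) * u') (at t)"
      if "(u has_real_derivative u') (at t)" for u u' t
      using DERIV_chain2[OF F that] .
    have "((\<lambda>x. A F i x) has_real_derivative A F' i x) (at x)" for i
      unfolding A_def by (intro DERIV_cdivide) (auto intro!: derivative_eq_intros F F')
    then show ?thesis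
      unfolding U_def[abs_def] by (intro DERIV_sum DERIV_cmult)
  qed
  have A_int: "((\<lambda>t. (1 - t) * (f (x + s i * t) + f (x - s i * t))) has_integral A F2 i x) {0..1}" for i x
    unfolding A_def using s[of i] by (intro has_integral_second_difference[OF F1 F2]) auto
  have U2_deriv: "(U F2 has_real_derivative U F1 x) (at x)"
    and U1_deriv: "(U F1 has_real_derivative U f x) (at x)" for x
    using U_deriv F1 F2 by blast+
  have "A F2 i (x + 2*pi) = A F2 i x" for i x
  proof -
    have "f (x + 2*pi + a) = f (x + a)" "f (x + 2*pi - a) = f (x - a)" for a
      using fper[of "x + a"] fper[of "x - a"] by (simp_all add: algebra_simps)
    then show ?thesis using A_int[of "x + 2*pi" i] A_int[of x i] has_integral_unique by simp
  qed
  then have U2_per: "U F2 (x + 2*pi) = U F2 x" for x by (simp add: U_def)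
  then have U1_per: "U F1 (x + 2*pi) = U F1 x" for x
  proof -
    have "((\<lambda>x. U F2 (x + 2*pi)) has_real_derivative U F1 (x + 2*pi)) (at x)"
      using U2_deriv[of "x + 2*pi"] by (simp add: DERIV_shift)
    then show ?thesis using U2_deriv[of x] by (simp add: U2_per DERIV_unique)
  qed
  have U2C: "U F2 \<in> periodic_C"
    using U2_per U2_deriv unfolding periodic_C_def
    by (auto intro: DERIV_continuous_on has_field_derivative_at_within)
  have U1C: "U F1 \<in> periodic_C"
    using U1_per U1_deriv unfolding periodic_C_def
    by (auto intro: DERIV_continuous_on has_field_derivative_at_within)
  have UF: "U F = (\<lambda>x. \<Sum>i<k. (w i / (s i)\<^sup>2) * ((F (x + s i) + (-2) * F x) + F (x + (- s i))))" for F
    by (simp add: U_def A_def fun_eq_iff)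
  have UfC: "U f \<in> periodic_C"
    unfolding UF by (intro periodic_C_sum periodic_C_scale periodic_C_add periodic_C_shift f)
  have U\<sigma>: "U \<sigma> \<in> trig_polys (n - 1)"
    unfolding UF by (intro trig_polys_sum trig_polys_scale trig_polys_add trig_polys_shift \<sigma>)

  have "\<bar>U f x - U \<sigma> x\<bar> \<le> 12 * M / h\<^sup>2" for x
  proof -
    define e where "e x = f x - \<sigma> x" for x
    have e: "\<bar>e x\<bar> \<le> M" for x using M by (simp add: e_def)
    have M0: "0 \<le> M" using e[of 0] by linarith
    have "U f x - U \<sigma> x = (\<Sum>i<k. w i / (s i)\<^sup>2 * (e (x + s i) + e (x - s i)))
        - 2 * e x * (\<Sum>i<k. w i / (s i)\<^sup>2)"
      unfolding UF e_def sum_distrib_left sum_subtractf[symmetric]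
      by (intro sum.cong refl) (simp add: algebra_simps add_divide_distrib diff_divide_distrib)
    moreover have "\<bar>\<Sum>i<k. w i / (s i)\<^sup>2 * (e (x + s i) + e (x - s i))\<bar>
        \<le> (\<Sum>i<k. \<bar>w i\<bar> / (s i)\<^sup>2 * (2 * M))"
    proof (intro order_trans[OF sum_abs] sum_mono)
      fix i
      have "\<bar>e (x + s i) + e (x - s i)\<bar> \<le> 2 * M"
        using e[of "x + s i"] e[of "x - s i"] by linarith
      then show "\<bar>w i / (s i)\<^sup>2 * (e (x + s i) + e (x - s i))\<bar> \<le> \<bar>w i\<bar> / (s i)\<^sup>2 * (2 * M)"
        by (simp add: abs_mult divide_right_mono mult_left_mono)
    qed
    moreover have "\<bar>2 * e x * (\<Sum>i<k. w i / (s i)\<^sup>2)\<bar> \<le> 2 * M * \<bar>\<Sum>i<k. w i / (s i)\<^sup>2\<bar>"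
      using e[of x] by (simp add: abs_mult mult_right_mono)
    ultimately have "\<bar>U f x - U \<sigma> x\<bar>
        \<le> (\<Sum>i<k. \<bar>w i\<bar> / (s i)\<^sup>2 * (2 * M)) + 2 * M * \<bar>\<Sum>i<k. w i / (s i)\<^sup>2\<bar>"
      by linarith
    also have "\<dots> = 2 * M * ((\<Sum>i<k. \<bar>w i\<bar> / (s i)\<^sup>2) + \<bar>\<Sum>i<k. w i / (s i)\<^sup>2\<bar>)"
      unfolding sum_distrib_right[symmetric] by (simp only: distrib_left mult.commute)
    also have "(\<Sum>i<k. \<bar>w i\<bar> / (s i)\<^sup>2) = (\<Sum>i<k. \<bar>w i\<bar> / (real (Suc i))\<^sup>2) / h\<^sup>2"
      by (simp add: sum_divide_distrib s_def power_mult_distrib)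
    also have "(\<Sum>i<k. w i / (s i)\<^sup>2) = (\<Sum>i<k. w i / (real (Suc i))\<^sup>2) / h\<^sup>2"
      by (simp add: sum_divide_distrib s_def power_mult_distrib)
    also have "2 * M * ((\<Sum>i<k. \<bar>w i\<bar> / (real (Suc i))\<^sup>2) / h\<^sup>2 + \<bar>(\<Sum>i<k. w i / (real (Suc i))\<^sup>2) / h\<^sup>2\<bar>)
       = 2 * M / h\<^sup>2 * ((\<Sum>i<k. \<bar>w i\<bar> / (real (Suc i))\<^sup>2) + \<bar>\<Sum>i<k. w i / (real (Suc i))\<^sup>2\<bar>)"
      by (simp add: add_divide_distrib distrib_left)
    also have "\<dots> \<le> 2 * M / h\<^sup>2 * 6"
      unfolding w_def using M0 by (intro mult_left_mono smoothing_weight_bound) auto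
    finally show ?thesis by simp
  qed
  from favard_inequality[OF n U1C UfC U1_deriv U\<sigma> this]
  obtain \<tau>1 where \<tau>1: "\<tau>1 \<in> trig_polys (n - 1)"
    "\<And>x. \<bar>U F1 x - \<tau>1 x\<bar> \<le> pi / (2 * real n) * (12 * M / h\<^sup>2)" by blast
  from favard_inequality[OF n U2C U1C U2_deriv \<tau>1]
  obtain \<tau> where \<tau>: "\<tau> \<in> trig_polys (n - 1)"
    "\<And>x. \<bar>U F2 x - \<tau> x\<bar> \<le> pi / (2 * real n) * (pi / (2 * real n) * (12 * M / h\<^sup>2))" by blast
  have q: "pi / (2 * real n) * (pi / (2 * real n) * (12 * M / h\<^sup>2)) = 3/4 * M"
    using n by (simp add: h_def field_simps power2_eq_square)

  have fU: "\<bar>f x - U F2 x\<bar> \<le> \<omega> / C" for x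
  proof -
    \<comment> \<open>The weight \<open>1 - t\<close> has mass \<open>1/2\<close> on \<open>[0, 1]\<close>, which cancels the factor 2 in front of the difference.\<close>
    have hat: "((\<lambda>t. (1 - t) * c) has_integral c / 2) {0..1}" for c :: real
    proof -
      have "((\<lambda>t. (1 - t) * c) has_integral ((1 - 1\<^sup>2 / 2) * c - (0 - 0\<^sup>2 / 2) * c)) {0..1}"
        by (rule has_integral_of_derivative) (auto intro!: derivative_eq_intros simp: algebra_simps)
      then show ?thesis by simp
    qed
    define \<Delta> where "\<Delta> t = (1 - t) * (2 * f x) - (\<Sum>i<k. w i * ((1 - t) * (f (x + s i * t) + f (x - s i * t))))" for t
    have int: "(\<Delta> has_integral (2 * f x / 2 - U F2 x)) {0..1}"
      unfolding \<Delta>_def[abs_def] U_def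
      by (intro has_integral_diff hat has_integral_sum has_integral_mult_right A_int) auto
    have \<Delta>_eq: "\<Delta> t = (1 - t) * (2 / C * ((-1) ^ k * fin_diff (2*k) (h * t) f (x - real k * (h * t))))" for t
    proof -
      have "(\<Sum>i=1..k. (-1) ^ i * real (2*k choose (k + i)) * (f (x + real i * (h * t)) + f (x - real i * (h * t))))
         = (\<Sum>i<k. (-1) ^ Suc i * real (2*k choose (k + Suc i)) * (f (x + s i * t) + f (x - s i * t)))"
        unfolding s_def mult.assoc
        by (rule sum.reindex_bij_witness[of _ Suc "\<lambda>i. i - 1"]) auto
      also have "\<dots> = - (C / 2 * (\<Sum>i<k. w i * (f (x + s i * t) + f (x - s i * t))))"
        unfolding sum_distrib_left sum_negf[symmetric]
        using C by (intro sum.cong refl)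
          (simp add: w_def smoothing_weight_def central_ratio_def C_def)
      finally have "(-1) ^ k * fin_diff (2*k) (h * t) f (x - real k * (h * t))
          = C * f x - C / 2 * (\<Sum>i<k. w i * (f (x + s i * t) + f (x - s i * t)))"
        unfolding fin_diff_even_centered by (simp add: C_def)
      then have "2 / C * ((-1) ^ k * fin_diff (2*k) (h * t) f (x - real k * (h * t)))
          = 2 * f x - (\<Sum>i<k. w i * (f (x + s i * t) + f (x - s i * t)))"
        using C by (simp add: field_simps)
      then show ?thesis
        unfolding \<Delta>_def by (simp add: right_diff_distrib sum_distrib_left mult.left_commute)
    qed
    \<comment> \<open>The step \<open>h t\<close> is admissible in the modulus except at \<open>t = 0\<close>, where the difference is zero.\<close>
    have bound: "\<bar>\<Delta> t\<bar> \<le> (1 - t) * (2 / C * \<omega>)" if t: "t \<in> {0..1}" for t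
    proof -
      have "\<bar>fin_diff (2*k) (h * t) f (x - real k * (h * t))\<bar> \<le> \<omega>"
      proof (cases "t = 0")
        case True
        then show ?thesis using k modulus_nonneg[OF f h] by (simp add: fin_diff_zero_step \<omega>_def)
      next
        case False
        then show ?thesis unfolding \<omega>_def using t h
          by (intro fin_diff_le_modulus[OF f]) (auto simp: mult_left_le)
      qed
      then show ?thesis unfolding \<Delta>_eq using t C
        by (simp add: abs_mult mult_left_mono divide_right_mono)
    qed
    have "norm (integral {0..1} \<Delta>) \<le> integral {0..1} (\<lambda>t. (1 - t) * (2 / C * \<omega>))"
      by (rule integral_norm_bound_integral[OF has_integral_integrable[OF int] has_integral_integrable[OF hat]])
        (use bound in auto)
    then show ?thesis unfolding integral_unique[OF int] integral_unique[OF hat] by simp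
  qed
  have "best_approx (n - 1) f \<le> \<omega> / C + 3/4 * M"
  proof (rule best_approx_le[OF f \<tau>(1)])
    fix x
    show "\<bar>f x - \<tau> x\<bar> \<le> \<omega> / C + 3/4 * M"
      using fU[of x] \<tau>(2)[of x] unfolding q by linarith
  qed
  then show ?thesis by (simp add: \<omega>_def C_def h_def)
qed

text \<open>
The infimum over \<open>\<sigma>\<close> in the previous lemma turns it into \<open>E \<le> e + (3/4) E\<close>.
\<close>

lemma best_approx_le_even_modulus:
  assumes f: "f \<in> periodic_C" and n: "0 < n" and k: "0 < k"
  shows "best_approx (n - 1) f \<le> 4 / real (2*k choose k) * modulus_smoothness (2*k) f (2*pi / real n)"
proof -
  define e where "e = modulus_smoothness (2*k) f (2*pi / real n) / real (2*k choose k)"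
  have "4/3 * (best_approx (n - 1) f - e) \<le> best_approx (n - 1) f"
  proof (rule best_approx_ge[OF f])
    fix \<sigma> M assume "\<sigma> \<in> trig_polys (n - 1)" "\<And>x. \<bar>f x - \<sigma> x\<bar> \<le> M"
    from smoothing_step[OF f n k this]
    show "4/3 * (best_approx (n - 1) f - e) \<le> M" by (simp add: e_def)
  qed
  then show ?thesis by (simp add: e_def)
qed

lemma best_approx_le_modulus:
  assumes f: "f \<in> periodic_C" and n: "0 < n" and r: "0 < r"
  shows "best_approx (n - 1) f \<le> 4 * gamma_star r * modulus_smoothness r f (2*pi / real n)"
proof (cases "even r")
  case True
  then obtain k where "r = 2 * k" by (elim evenE)
  then show ?thesis using best_approx_le_even_modulus[OF f n, of k] r by (simp add: gamma_star_def)
next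
  case False
  then obtain j where j: "r = 2 * j + 1" by (elim oddE)
  define \<delta> where "\<delta> = 2 * pi / real n"
  have e: "2 * Suc j = Suc r" using j by simp
  have c: "Suc r choose Suc j = 2 * (r choose j)"
    using binomial_symmetric[of j r] j by simp
  have "best_approx (n - 1) f \<le> 4 / real (2 * Suc j choose Suc j) * modulus_smoothness (2 * Suc j) f \<delta>"
    unfolding \<delta>_def by (rule best_approx_le_even_modulus[OF f n]) simp
  also have "\<dots> = 2 / real (r choose j) * modulus_smoothness (Suc r) f \<delta>"
    unfolding e unfolding c by simp
  also have "\<dots> \<le> 2 / real (r choose j) * (2 * modulus_smoothness r f \<delta>)"
    using n by (intro mult_left_mono modulus_Suc_le f) (auto simp: \<delta>_def)
  also have "\<dots> = 4 * gamma_star r * modulus_smoothness r f \<delta>"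
    using j by (simp add: gamma_star_def)
  finally show ?thesis unfolding \<delta>_def .
qed

section \<open>The lower bound\<close>

text \<open>
One difference is applied to \<open>f\<close> first; the remaining \<open>q\<close> have coefficients bounded by the central one.
\<close>

lemma fin_diff_Suc_le_variation:
  "\<bar>fin_diff (Suc q) h f x\<bar>
     \<le> real (q choose (q div 2)) * (\<Sum>j\<le>q. \<bar>f (x + real j * h) - f (x + real (Suc j) * h)\<bar>)"
proof -
  have arg: "x + real (Suc j) * h = x + real j * h + h" for j by (simp add: algebra_simps)
  have "\<bar>fin_diff (Suc q) h f x\<bar>
      \<le> (\<Sum>j\<le>q. real (q choose j) * \<bar>f (x + real j * h) - f (x + real (Suc j) * h)\<bar>)"
    unfolding fin_diff_Suc_diff arg unfolding fin_diff_def
    by (rule order_trans[OF sum_abs]) (simp add: abs_mult)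
  also have "\<dots> \<le> (\<Sum>j\<le>q. real (q choose (q div 2)) * \<bar>f (x + real j * h) - f (x + real (Suc j) * h)\<bar>)"
    by (intro sum_mono mult_right_mono) (auto intro: binomial_maximum)
  finally show ?thesis by (simp add: sum_distrib_left)
qed

text \<open>
The sign function with its jump replaced by a ramp on \<open>[-\<epsilon>, \<epsilon>]\<close>; composed with the sine it
gives a continuous square wave.
\<close>

definition unit_ramp :: "real \<Rightarrow> real \<Rightarrow> real" where
  "unit_ramp \<epsilon> y = max (-1) (min 1 (y / \<epsilon>))"

lemma unit_ramp_mono: "0 < \<epsilon> \<Longrightarrow> y \<le> z \<Longrightarrow> unit_ramp \<epsilon> y \<le> unit_ramp \<epsilon> z"
  unfolding unit_ramp_def by (intro max.mono min.mono divide_right_mono) auto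

lemma unit_ramp_minus: "unit_ramp \<epsilon> (- y) = - unit_ramp \<epsilon> y"
  by (simp add: unit_ramp_def max_def min_def)

lemma abs_unit_ramp_le: "\<bar>unit_ramp \<epsilon> y\<bar> \<le> 1"
  by (auto simp: unit_ramp_def)

text \<open>
The function rises on \<open>[-\<pi>, 0]\<close> and falls on \<open>[0, \<pi>]\<close>, so its variation over \<open>[u, v]\<close> with \<open>u \<le> 0 < v\<close> is
\<open>2 F 0 - F u - F v\<close>. If \<open>v \<le> u + \<pi>\<close> then \<open>F v \<ge> F (u + \<pi>) = - F u\<close>, which leaves at most \<open>2 F 0\<close>.
\<close>

lemma variation_even_unimodal:
  fixes F :: "real \<Rightarrow> real"
  assumes mono: "\<And>u v. 0 \<le> u \<Longrightarrow> u \<le> v \<Longrightarrow> v \<le> pi \<Longrightarrow> F v \<le> F u"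
    and even: "\<And>u. F (- u) = F u" and anti: "\<And>u. F (u + pi) = - F u"
    and bound: "\<And>u. \<bar>F u\<bar> \<le> 1"
    and u: "- pi \<le> u" "u \<le> 0" and h: "0 \<le> h" "real (Suc q) * h \<le> pi"
  shows "(\<Sum>j\<le>q. \<bar>F (u + real j * h) - F (u + real (Suc j) * h)\<bar>) \<le> 2"
proof -
  \<comment> \<open>The signed variation of \<open>F\<close> from 0, up to the additive constant \<open>F 0\<close>.\<close>
  define W where "W v = (if v \<le> 0 then F v else 2 * F 0 - F v)" for v
  have mono': "F v \<le> F w" if "- pi \<le> v" "v \<le> w" "w \<le> 0" for v w
    using mono[of "-w" "-v"] that by (simp add: even)
  have W: "\<bar>F v - F w\<bar> \<le> W w - W v" if "- pi \<le> v" "v \<le> w" "w \<le> pi" for v w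
  proof -
    consider "w \<le> 0" | "v \<le> 0" "0 < w" | "0 < v" using that by linarith
    then show ?thesis
    proof cases
      case 1 then show ?thesis using that mono'[of v w] by (simp add: W_def)
    next
      case 2 then show ?thesis using that mono'[of v 0] mono[of 0 w] by (simp add: W_def)
    next
      case 3 then show ?thesis using that mono[of v w] by (simp add: W_def)
    qed
  qed
  have "(\<Sum>j<Suc q. \<bar>F (u + real j * h) - F (u + real (Suc j) * h)\<bar>)
     \<le> (\<Sum>j<Suc q. W (u + real (Suc j) * h) - W (u + real j * h))"
  proof (intro sum_mono W)
    fix j assume j: "j \<in> {..<Suc q}"
    show "- pi \<le> u + real j * h" using u h by (simp add: add_increasing2)
    show "u + real j * h \<le> u + real (Suc j) * h" using h by (simp add: mult_right_mono)
    have "real (Suc j) * h \<le> real (Suc q) * h" using j h by (intro mult_right_mono) auto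
    then show "u + real (Suc j) * h \<le> pi" using u h by linarith
  qed
  also have "\<dots> = W (u + real (Suc q) * h) - W u"
    using sum_lessThan_telescope[of "\<lambda>j. W (u + real j * h)" "Suc q"] by simp
  also have "\<dots> \<le> 2"
  proof (cases "u + real (Suc q) * h \<le> 0")
    case True
    then show ?thesis using u bound[of u] bound[of "u + real (Suc q) * h"] by (simp add: W_def)
  next
    case False
    have "- F u = F (u + pi)" by (simp add: anti)
    also have "\<dots> \<le> F (u + real (Suc q) * h)"
      using False u h by (intro mono) auto
    finally show ?thesis using False u bound[of 0] by (simp add: W_def)
  qed
  finally show ?thesis by (simp only: lessThan_Suc_atMost)
qed

lemma variation_unit_ramp_sin:
  assumes \<epsilon>: "0 < \<epsilon>" and h: "0 \<le> h" "real (Suc q) * h \<le> pi"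
  shows "(\<Sum>j\<le>q. \<bar>unit_ramp \<epsilon> (sin (x + real j * h)) - unit_ramp \<epsilon> (sin (x + real (Suc j) * h))\<bar>) \<le> 2"
proof -
  \<comment> \<open>The interval \<open>[x, x + \<pi>]\<close> contains an extremal point \<open>c\<close> of the sine; around it the function is even and unimodal.\<close>
  define m where "m = \<lceil>x / pi - 1/2\<rceil>"
  define c where "c = pi / 2 + of_int m * pi"
  have m: "x / pi - 1/2 \<le> of_int m" "of_int m < x / pi - 1/2 + 1"
    unfolding m_def by linarith+
  have c: "x \<le> c" "c \<le> x + pi"
    using mult_right_mono[OF m(1), of pi] mult_right_mono[OF less_imp_le[OF m(2)], of pi]
    by (simp_all add: c_def algebra_simps)
  define F where "F u = unit_ramp \<epsilon> (cos u)" for u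
  obtain s :: real where s: "s = 1 \<or> s = -1" "cos (of_int m * pi) = s"
    using cos_npi_int[of m] that[of "if even m then 1 else -1"] by (auto simp: mult.commute)
  have sin_c: "sin (c + u) = s * cos u" for u
  proof -
    have "sin (c + u) = sin ((of_int m * pi + u) + pi / 2)" by (simp add: c_def algebra_simps)
    also have "\<dots> = cos (of_int m * pi + u)" by (simp only: sin_add) simp
    also have "\<dots> = s * cos u" unfolding cos_add s using sin_npi_int[of m] by (simp add: mult.commute)
    finally show ?thesis .
  qed
  have "unit_ramp \<epsilon> (s * y) = s * unit_ramp \<epsilon> y" for y using s unit_ramp_minus by auto
  then have "unit_ramp \<epsilon> (sin (x + v)) = s * F ((x - c) + v)" for v
    using sin_c[of "(x - c) + v"] by (simp add: F_def)
  then have "(\<Sum>j\<le>q. \<bar>unit_ramp \<epsilon> (sin (x + real j * h)) - unit_ramp \<epsilon> (sin (x + real (Suc j) * h))\<bar>)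
     = (\<Sum>j\<le>q. \<bar>F ((x - c) + real j * h) - F ((x - c) + real (Suc j) * h)\<bar>)"
    using s by (auto intro!: sum.cong simp: abs_minus_commute)
  also have "\<dots> \<le> 2"
    using c h
    by (intro variation_even_unimodal)
      (auto simp: F_def unit_ramp_minus abs_unit_ramp_le cos_add intro!: unit_ramp_mono \<epsilon> cos_monotone_0_pi_le)
  finally show ?thesis .
qed

lemma unit_ramp_sin_periodic_C: "(\<lambda>x. unit_ramp \<epsilon> (sin x)) \<in> periodic_C"
  by (auto simp: periodic_C_def unit_ramp_def divide_inverse intro!: continuous_intros)

text \<open>
The square wave climbs from \<open>-1\<close> to \<open>1\<close> within \<open>[-\<delta>, \<delta>]\<close>. An approximant with error \<open>M < 1\<close> has to climb
by \<open>2 (1 - M)\<close> there, and its Lipschitz bound allows this only if \<open>M\<close> is close to 1.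
\<close>

lemma best_approx_unit_ramp_sin:
  assumes n: "0 < n" and \<delta>: "0 < \<delta>" "\<delta> < pi / 2"
  shows "1 - 4 * (real n)\<^sup>2 * \<delta> \<le> best_approx (n - 1) (\<lambda>x. unit_ramp (sin \<delta>) (sin x))"
proof (rule best_approx_ge[OF unit_ramp_sin_periodic_C])
  fix \<tau> M assume \<tau>: "\<tau> \<in> trig_polys (n - 1)"
    and M: "\<And>x. \<bar>unit_ramp (sin \<delta>) (sin x) - \<tau> x\<bar> \<le> M"
  show "1 - 4 * (real n)\<^sup>2 * \<delta> \<le> M"
  proof (cases "M \<ge> 1")
    case True
    moreover have "0 \<le> 4 * (real n)\<^sup>2 * \<delta>" using \<delta> by simp
    ultimately show ?thesis by linarith
  next
    case False
    have s: "sin \<delta> > 0" using \<delta> by (intro sin_gt_zero) auto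
    have "\<bar>\<tau> x\<bar> \<le> 2" for x
      using M[of x] abs_unit_ramp_le[of "sin \<delta>" "sin x"] False by linarith
    from trig_poly_lipschitz[OF \<tau> n this, of \<delta> "-\<delta>"]
    have "\<bar>\<tau> \<delta> - \<tau> (-\<delta>)\<bar> \<le> 8 * ((real n)\<^sup>2 * \<delta>)" using \<delta> by simp
    moreover have "unit_ramp (sin \<delta>) (sin \<delta>) = 1" "unit_ramp (sin \<delta>) (sin (-\<delta>)) = -1"
      using s by (simp_all add: unit_ramp_def)
    ultimately show ?thesis using M[of \<delta>] M[of "-\<delta>"] by linarith
  qed
qed

lemma lower_const_gamma_star:
  "lower_const (Suc q) * gamma_star (Suc q) = 1 / (2 * real (q choose (q div 2)))"
proof (cases "even q")
  case True
  then obtain k where q: "q = 2 * k" by (elim evenE)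
  have "Suc k * (Suc q choose Suc k) = Suc q * (q choose k)" by (rule Suc_times_binomial)
  moreover have "Suc q choose Suc k = Suc q choose k"
    using binomial_symmetric[of "Suc k" "Suc q"] q by simp
  ultimately have e: "real (Suc k) * real (Suc q choose k) = real (Suc q) * real (q choose k)"
    by (metis of_nat_mult)
  have p: "real (q choose k) > 0" "real (Suc q choose k) > 0" using q by (auto intro!: zero_less_binomial)
  have d: "Suc q div 2 = k" "q div 2 = k" using q by auto
  have "lower_const (Suc q) = real (Suc q) / (2 * real (Suc k))"
    using q by (simp add: lower_const_def field_simps)
  then have "lower_const (Suc q) * gamma_star (Suc q) = real (Suc q) / (2 * (real (Suc k) * real (Suc q choose k)))"
    by (simp add: gamma_star_def d)
  also have "\<dots> = 1 / (2 * real (q choose (q div 2)))" unfolding e d by (simp del: of_nat_Suc)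
  finally show ?thesis .
next
  case False
  then obtain k where q: "q = 2 * k + 1" by (elim oddE)
  have d: "Suc q div 2 = Suc k" "q div 2 = k" using q by auto
  have "q choose Suc k = q choose k" using binomial_symmetric[of k q] q by simp
  then have "Suc q choose Suc k = 2 * (q choose k)" by simp
  then show ?thesis using False by (simp add: lower_const_def gamma_star_def d)
qed

section \<open>The Jackson--Stechkin constant\<close>

lemma jackson_sup_upper:
  assumes r: "0 < r" and n: "0 < n"
  shows "jackson_sup r n \<le> ereal (5 * gamma_star r)"
  unfolding jackson_sup_def
proof (rule SUP_least)
  fix f assume "f \<in> {f \<in> periodic_C. modulus_smoothness r f (2 * pi / real n) \<noteq> 0}"
  then have f: "f \<in> periodic_C" and ne: "modulus_smoothness r f (2 * pi / real n) \<noteq> 0" by auto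
  define \<omega> where "\<omega> = modulus_smoothness r f (2 * pi / real n)"
  have \<omega>: "0 < \<omega>" using ne modulus_nonneg[OF f, of "2 * pi / real n" r] n by (simp add: \<omega>_def)
  have "0 \<le> gamma_star r" by (simp add: gamma_star_def)
  then have "4 * gamma_star r * \<omega> \<le> 5 * gamma_star r * \<omega>"
    using \<omega> by (intro mult_right_mono) auto
  then have "best_approx (n - 1) f \<le> 5 * gamma_star r * \<omega>"
    using best_approx_le_modulus[OF f n r] unfolding \<omega>_def by linarith
  then show "ereal (best_approx (n - 1) f / modulus_smoothness r f (2 * pi / real n)) \<le> ereal (5 * gamma_star r)"
    using \<omega> by (simp add: \<omega>_def[symmetric] pos_divide_le_eq)
qed

text \<open>
The steep square waves are admissible in the supremum: their modulus cannot vanish, because the upper estimate would then force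
their best approximation to be 0.
\<close>

lemma jackson_sup_lower:
  assumes r: "0 < r" and n: "2 * r \<le> n"
  shows "ereal (lower_const r * gamma_star r) \<le> jackson_sup r n"
proof -
  obtain q where q: "r = Suc q" using r by (cases r) auto
  define C where "C = real (q choose (q div 2))"
  define h where "h = 2 * pi / real n"
  have n0: "0 < n" using r n by simp
  have "0 < (q choose (q div 2))" by (rule zero_less_binomial) simp
  then have C: "1 \<le> C" unfolding C_def by linarith
  have h: "0 < h" using n0 by (simp add: h_def)
  have rh: "real r * h \<le> pi"
  proof -
    have "2 * real r \<le> real n" using n by linarith
    then have "2 * real r * pi \<le> real n * pi" by (intro mult_right_mono) auto
    then show ?thesis using n0 by (simp add: h_def field_simps)
  qed
  have "ereal (1 / (2 * C)) \<le> jackson_sup r n + ereal e" if e: "0 < e" for e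
  proof -
    \<comment> \<open>The scale \<open>1/n\<^sup>2\<close> balances the Lipschitz constant; the cap \<open>1/8\<close> keeps the error of best approximation at least \<open>1/2\<close>.\<close>
    define \<delta> where "\<delta> = min (1/8) (e/2) / (real n)\<^sup>2"
    define f where "f x = unit_ramp (sin \<delta>) (sin x)" for x
    define \<omega> where "\<omega> = modulus_smoothness r f h"
    have \<delta>: "0 < \<delta>" "\<delta> < pi / 2"
    proof -
      show "0 < \<delta>" using e n0 by (simp add: \<delta>_def)
      have "1 \<le> (real n)\<^sup>2" using n0 by simp
      then have "\<delta> \<le> (1/8) / 1" unfolding \<delta>_def using e by (intro frac_le) auto
      then show "\<delta> < pi / 2" using pi_gt3 by simp
    qed
    have n2: "4 * (real n)\<^sup>2 * \<delta> = 4 * min (1/8) (e/2)" using n0 by (simp add: \<delta>_def)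
    have fC: "f \<in> periodic_C" unfolding f_def[abs_def] by (rule unit_ramp_sin_periodic_C)
    have E: "1 - 4 * min (1/8) (e/2) \<le> best_approx (n - 1) f"
      using best_approx_unit_ramp_sin[OF n0 \<delta>] unfolding n2 f_def[abs_def] .
    have "\<omega> \<le> 2 * C"
      unfolding \<omega>_def
    proof (rule modulus_le[OF h])
      fix t x assume t: "0 < t" "t \<le> h"
      have "real r * t \<le> real r * h" using t by (intro mult_left_mono) auto
      then have rt: "real (Suc q) * t \<le> pi" using rh unfolding q by linarith
      have "0 < sin \<delta>" using \<delta> by (intro sin_gt_zero) auto
      from variation_unit_ramp_sin[OF this _ rt, of x] t
      have v: "(\<Sum>j\<le>q. \<bar>f (x + real j * t) - f (x + real (Suc j) * t)\<bar>) \<le> 2"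
        unfolding f_def by simp
      have "\<bar>fin_diff r t f x\<bar> \<le> C * (\<Sum>j\<le>q. \<bar>f (x + real j * t) - f (x + real (Suc j) * t)\<bar>)"
        unfolding q C_def by (rule fin_diff_Suc_le_variation)
      also have "\<dots> \<le> C * 2" using v C by (intro mult_left_mono) auto
      finally show "\<bar>fin_diff r t f x\<bar> \<le> 2 * C" by simp
    qed
    moreover have "0 < \<omega>"
    proof -
      have "0 < 4 * gamma_star r * \<omega>"
        using E best_approx_le_modulus[OF fC n0 r] unfolding \<omega>_def h_def by linarith
      then show ?thesis using modulus_nonneg[OF fC h, of r]
        by (simp add: \<omega>_def zero_less_mult_iff)
    qed
    ultimately have "(1 - 4 * min (1/8) (e/2)) / (2 * C) \<le> best_approx (n - 1) f / \<omega>"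
      using E by (intro frac_le) auto
    moreover have "1 / (2 * C) - e \<le> (1 - 4 * min (1/8) (e/2)) / (2 * C)"
    proof -
      have "4 * min (1/8) (e/2) / (2 * C) \<le> 2 * e / 2" using C e by (intro frac_le) auto
      then show ?thesis by (simp add: diff_divide_distrib)
    qed
    ultimately have "1 / (2 * C) - e \<le> best_approx (n - 1) f / \<omega>" by linarith
    moreover have "ereal (best_approx (n - 1) f / \<omega>) \<le> jackson_sup r n"
      unfolding jackson_sup_def \<omega>_def h_def
    proof (rule SUP_upper)
      show "f \<in> {f \<in> periodic_C. modulus_smoothness r f (2 * pi / real n) \<noteq> 0}"
        using fC \<open>0 < \<omega>\<close> unfolding \<omega>_def h_def by simp
    qed
    ultimately have "ereal (1 / (2 * C) - e) \<le> jackson_sup r n"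
      by (rule order_trans[OF iffD2[OF ereal_less_eq(3)]])
    then have "ereal (1 / (2 * C) - e) + ereal e \<le> jackson_sup r n + ereal e"
      by (rule add_right_mono)
    then show ?thesis by simp
  qed
  then have "ereal (1 / (2 * C)) \<le> jackson_sup r n" by (rule ereal_le_epsilon2)
  then show ?thesis unfolding q lower_const_gamma_star C_def .
qed

theorem theorem1:
  fixes r :: nat
  assumes "r \<ge> 1"
  shows "(\<forall>n::nat. n \<ge> 2 * r \<longrightarrow> ereal (lower_const r * gamma_star r) \<le> jackson_sup r n) \<and>
         (\<forall>n::nat. n \<ge> 1 \<longrightarrow> jackson_sup r n \<le> ereal (5 * gamma_star r))"
proof (intro conjI allI impI)
  fix n :: nat
  assume "n \<ge> 2 * r"
  with assms show "ereal (lower_const r * gamma_star r) \<le> jackson_sup r n"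
    by (intro jackson_sup_lower) simp_all
next
  fix n :: nat
  assume "n \<ge> 1"
  with assms show "jackson_sup r n \<le> ereal (5 * gamma_star r)"
    by (intro jackson_sup_upper) simp_all
qed

end
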